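(* Let $n\ge 3$, and let $\Bbbk$ be a field whose characteristic does not divide $2n^2$ and which contains a primitive $n$-th root of unity $q$. The generalized Kac--Paljutkin Hopf algebra $H_{2n^2}$ has no non-zero infinitesimal $\mathcal{R}$-matrices: for every quasitriangular structure $\mathcal{R}$ on $H_{2n^2}$, if $\chi$ is an infinitesimal $\mathcal{R}$-matrix for $(H_{2n^2},\mathcal{R})$, then $\chi=0$.
   Context: $H_{2n^2}$ is the Hopf algebra generated as an algebra by $x,y,z$ with relations $x^n=1$, $y^n=1$, $xy=yx$, $zx=yz$, $zy=xz$, $z^2=\frac1n\sum_{i,j=0}^{n-1}q^{-ij}x^iy^j$, and with $\Delta(x)=x\otimes x$, $\Delta(y)=y\otimes y$, $\Delta(z)=\frac1n\sum_{i,j=0}^{n-1}q^{-ij}(x^i\otimes y^j)(z\otimes z)$, $\varepsilon(x)=\varepsilon(y)=\varepsilon(z)=1$, $S(x)=x^{n-1}$, $S(y)=y^{n-1}$, $S(z)=z$. It has basis $\{x^iy^j,\ x^iy^jz : 0\le i,j\le n-1\}$. For a bialgebra $H$ and $T=\sum_i T^i\otimes T_i\in H\otimes H$ write $T_{12}=T\otimes 1$, $T_{23}=1\otimes T$, $T_{13}=\sum_i T^i\otimes 1\otimes T_i$. A quasitriangular structure (universal $\mathcal{R}$-matrix) on $H$ is an invertible $\mathcal{R}\in H\otimes H$ with $\Delta^{\mathrm{op}}(h)=\mathcal{R}\Delta(h)\mathcal{R}^{-1}$ for all $h$, $(\mathrm{Id}\otimes\Delta)(\mathcal{R})=\mathcal{R}_{13}\mathcal{R}_{12}$,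 $(\Delta\otimes\mathrm{Id})(\mathcal{R})=\mathcal{R}_{13}\mathcal{R}_{23}$. An infinitesimal $\mathcal{R}$-matrix for $(H,\mathcal{R})$ is $\chi\in H\otimes H$ such that $\chi\Delta(h)=\Delta(h)\chi$ for all $h\in H$, $(\mathrm{Id}\otimes\Delta)(\chi)=\chi_{12}+\mathcal{R}_{12}^{-1}\chi_{13}\mathcal{R}_{12}$, and $(\Delta\otimes\mathrm{Id})(\chi)=\chi_{23}+\mathcal{R}_{23}^{-1}\chi_{13}\mathcal{R}_{23}$. *)

theory Defs
  imports
    "HOL-Library.Poly_Mapping"
    "HOL-Library.Product_Plus"
    "HOL-Algebra.QuotRing"
    "HOL-Algebra.Algebraic_Closure_Type"
begin

section \<open>Free algebras and their tensor powers\<close>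

text \<open>
  Words form a monoid under concatenation, written additively because the convolution product
  of \<^theory>\<open>HOL-Library.Poly_Mapping\<close> is based on the class \<^class>\<open>monoid_add\<close>; the empty word is 0.
\<close>

datatype 'g word = Word (letters: "'g list")

instantiation word :: (type) monoid_add
begin

definition zero_word :: "'g word" where
  "zero_word = Word []"

definition plus_word :: "'g word \<Rightarrow> 'g word \<Rightarrow> 'g word" where
  "plus_word u v = Word (letters u @ letters v)"

instance
  by standard (auto simp: zero_word_def plus_word_def)

end

text \<open>
  The ring of finitely supported functions on words is the free algebra \<open>F\<close> on the letters.
  Likewise finitely supported functions on pairs and triples of words, with componentwise
  concatenation, are \<open>F \<otimes> F\<close> and \<open>F \<otimes> F \<otimes> F\<close> with their tensor product multiplication:
  the pair \<open>(u, v)\<close> is the basis vector \<open>u \<otimes> v\<close>.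
\<close>

type_synonym ('g, 'k) free = "'g word \<Rightarrow>\<^sub>0 'k"
type_synonym ('g, 'k) free2 = "'g word \<times> 'g word \<Rightarrow>\<^sub>0 'k"
type_synonym ('g, 'k) free3 = "'g word \<times> 'g word \<times> 'g word \<Rightarrow>\<^sub>0 'k"

abbreviation scalar :: "'k::field \<Rightarrow> ('a::monoid_add \<Rightarrow>\<^sub>0 'k)" where
  "scalar c \<equiv> Poly_Mapping.single 0 c"

definition gen :: "'g \<Rightarrow> ('g, 'k::field) free" where
  "gen g = Poly_Mapping.single (Word [g]) 1"

definition lin_ext ::
  "('a \<Rightarrow> ('b::monoid_add \<Rightarrow>\<^sub>0 'k::field)) \<Rightarrow> ('a \<Rightarrow>\<^sub>0 'k) \<Rightarrow> ('b \<Rightarrow>\<^sub>0 'k)" where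
  "lin_ext f p = (\<Sum>a\<in>Poly_Mapping.keys p. scalar (Poly_Mapping.lookup p a) * f a)"

definition push :: "('a \<Rightarrow> 'b::monoid_add) \<Rightarrow> ('a \<Rightarrow>\<^sub>0 'k::field) \<Rightarrow> ('b \<Rightarrow>\<^sub>0 'k)" where
  "push f = lin_ext (\<lambda>a. Poly_Mapping.single (f a) 1)"

definition tens :: "('g, 'k::field) free \<Rightarrow> ('g, 'k) free \<Rightarrow> ('g, 'k) free2" where
  "tens a b = lin_ext (\<lambda>u. push (\<lambda>v. (u, v)) b) a"

definition leg12 :: "('g, 'k::field) free2 \<Rightarrow> ('g, 'k) free3" where
  "leg12 = push (\<lambda>(u, v). (u, v, 0))"

definition leg13 :: "('g, 'k::field) free2 \<Rightarrow> ('g, 'k) free3" where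
  "leg13 = push (\<lambda>(u, v). (u, 0, v))"

definition leg23 :: "('g, 'k::field) free2 \<Rightarrow> ('g, 'k) free3" where
  "leg23 = push (\<lambda>(u, v). (0, u, v))"


section \<open>Algebras presented by generators and relations\<close>

text \<open>
  \<open>H = F / I\<close>, where \<open>I\<close> is the two-sided ideal generated by a set of relators.  The kernels of
  \<open>F \<otimes> F \<rightarrow> H \<otimes> H\<close> and \<open>F \<otimes> F \<otimes> F \<rightarrow> H \<otimes> H \<otimes> H\<close> are \<open>I \<otimes> F + F \<otimes> I\<close> and its
  three-factor analogue, that is, the ideals generated by the copies of \<open>I\<close> in the tensor
  factors; \<open>H \<otimes> H\<close> and \<open>H \<otimes> H \<otimes> H\<close> are the quotients by them.
\<close>

lemma ring_ring_of_type_algebra: "ring (ring_of_type_algebra :: 'a::ring_1 ring)"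
proof -
  have "\<exists>y. x + y = 0" for x :: 'a
    using add.right_inverse by blast
  thus ?thesis
    unfolding ring_of_type_algebra_def using add.right_inverse
    by unfold_locales (auto simp: algebra_simps Units_def)
qed

definition ideal1 :: "('g, 'k::field) free set \<Rightarrow> ('g, 'k) free set" where
  "ideal1 rels = Idl\<^bsub>ring_of_type_algebra\<^esub> rels"

definition ideal2 :: "('g, 'k::field) free set \<Rightarrow> ('g, 'k) free2 set" where
  "ideal2 rels = Idl\<^bsub>ring_of_type_algebra\<^esub>
     (push (\<lambda>w. (w, 0)) ` ideal1 rels \<union> push (\<lambda>w. (0, w)) ` ideal1 rels)"

definition ideal3 :: "('g, 'k::field) free set \<Rightarrow> ('g, 'k) free3 set" where
  "ideal3 rels = Idl\<^bsub>ring_of_type_algebra\<^esub>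
     (push (\<lambda>w. (w, 0, 0)) ` ideal1 rels \<union> push (\<lambda>w. (0, w, 0)) ` ideal1 rels \<union>
      push (\<lambda>w. (0, 0, w)) ` ideal1 rels)"

definition alg1 :: "('g, 'k::field) free set \<Rightarrow> ('g, 'k) free set ring" where
  "alg1 rels = ring_of_type_algebra Quot ideal1 rels"

definition alg2 :: "('g, 'k::field) free set \<Rightarrow> ('g, 'k) free2 set ring" where
  "alg2 rels = ring_of_type_algebra Quot ideal2 rels"

definition alg3 :: "('g, 'k::field) free set \<Rightarrow> ('g, 'k) free3 set ring" where
  "alg3 rels = ring_of_type_algebra Quot ideal3 rels"

text \<open>
  The map between quotients induced by \<open>f\<close>, where \<open>J\<close> is the ideal of the target. As in
  \<^const>\<open>rcoset_mult\<close>, the union is over all representatives of the coset \<open>A\<close>; it is the single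
  coset \<open>J +> f a\<close> for any \<open>a \<in> A\<close> when \<open>f\<close> is additive and carries the source ideal into \<open>J\<close>.
\<close>

definition induced :: "'b::ring_1 set \<Rightarrow> ('a \<Rightarrow> 'b) \<Rightarrow> 'a set \<Rightarrow> 'b set" where
  "induced J f A = (\<Union>a\<in>A. J +>\<^bsub>ring_of_type_algebra\<^esub> f a)"


section \<open>Quasitriangular structures and infinitesimal R-matrices\<close>

text \<open>
  A bialgebra is given by relators \<open>rels\<close> and the values \<open>\<delta>\<close> of the comultiplication on the
  generators (as elements of \<open>F \<otimes> F\<close> representing elements of \<open>H \<otimes> H\<close>).  The counit enters
  neither of the two notions below.
\<close>

definition comul_free ::
  "('g \<Rightarrow> ('g, 'k::field) free2) \<Rightarrow> ('g, 'k) free \<Rightarrow> ('g, 'k) free2" where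
  "comul_free \<delta> = lin_ext (\<lambda>w. prod_list (map \<delta> (letters w)))"

definition id_comul_free ::
  "('g \<Rightarrow> ('g, 'k::field) free2) \<Rightarrow> ('g, 'k) free2 \<Rightarrow> ('g, 'k) free3" where
  "id_comul_free \<delta> =
     lin_ext (\<lambda>(u, v). push (\<lambda>(v1, v2). (u, v1, v2)) (comul_free \<delta> (Poly_Mapping.single v 1)))"

definition comul_id_free ::
  "('g \<Rightarrow> ('g, 'k::field) free2) \<Rightarrow> ('g, 'k) free2 \<Rightarrow> ('g, 'k) free3" where
  "comul_id_free \<delta> =
     lin_ext (\<lambda>(u, v). push (\<lambda>(u1, u2). (u1, u2, v)) (comul_free \<delta> (Poly_Mapping.single u 1)))"

definition quasitriangular_structure ::
  "('g, 'k::field) free set \<Rightarrow> ('g \<Rightarrow> ('g, 'k) free2) \<Rightarrow> ('g, 'k) free2 set \<Rightarrow> bool" where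
  "quasitriangular_structure rels \<delta> R \<longleftrightarrow>
     (let H = alg1 rels; HH = alg2 rels; HHH = alg3 rels;
          \<Delta> = induced (ideal2 rels) (comul_free \<delta>);
          \<Delta>op = induced (ideal2 rels) (push prod.swap \<circ> comul_free \<delta>);
          id_\<Delta> = induced (ideal3 rels) (id_comul_free \<delta>);
          \<Delta>_id = induced (ideal3 rels) (comul_id_free \<delta>);
          R12 = induced (ideal3 rels) leg12 R;
          R13 = induced (ideal3 rels) leg13 R;
          R23 = induced (ideal3 rels) leg23 R
      in R \<in> Units HH \<and>
         (\<forall>h\<in>carrier H. \<Delta>op h = R \<otimes>\<^bsub>HH\<^esub> \<Delta> h \<otimes>\<^bsub>HH\<^esub> inv\<^bsub>HH\<^esub> R) \<and>
         id_\<Delta> R = R13 \<otimes>\<^bsub>HHH\<^esub> R12 \<and>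
         \<Delta>_id R = R13 \<otimes>\<^bsub>HHH\<^esub> R23)"

definition infinitesimal_R_matrix ::
  "('g, 'k::field) free set \<Rightarrow> ('g \<Rightarrow> ('g, 'k) free2) \<Rightarrow>
   ('g, 'k) free2 set \<Rightarrow> ('g, 'k) free2 set \<Rightarrow> bool" where
  "infinitesimal_R_matrix rels \<delta> R \<chi> \<longleftrightarrow>
     (let H = alg1 rels; HH = alg2 rels; HHH = alg3 rels;
          \<Delta> = induced (ideal2 rels) (comul_free \<delta>);
          id_\<Delta> = induced (ideal3 rels) (id_comul_free \<delta>);
          \<Delta>_id = induced (ideal3 rels) (comul_id_free \<delta>);
          R12 = induced (ideal3 rels) leg12 R;
          R23 = induced (ideal3 rels) leg23 R;
          \<chi>12 = induced (ideal3 rels) leg12 \<chi>;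
          \<chi>13 = induced (ideal3 rels) leg13 \<chi>;
          \<chi>23 = induced (ideal3 rels) leg23 \<chi>
      in \<chi> \<in> carrier HH \<and>
         (\<forall>h\<in>carrier H. \<chi> \<otimes>\<^bsub>HH\<^esub> \<Delta> h = \<Delta> h \<otimes>\<^bsub>HH\<^esub> \<chi>) \<and>
         id_\<Delta> \<chi> = \<chi>12 \<oplus>\<^bsub>HHH\<^esub> (inv\<^bsub>HHH\<^esub> R12 \<otimes>\<^bsub>HHH\<^esub> \<chi>13 \<otimes>\<^bsub>HHH\<^esub> R12) \<and>
         \<Delta>_id \<chi> = \<chi>23 \<oplus>\<^bsub>HHH\<^esub> (inv\<^bsub>HHH\<^esub> R23 \<otimes>\<^bsub>HHH\<^esub> \<chi>13 \<otimes>\<^bsub>HHH\<^esub> R23))"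


section \<open>The generalized Kac--Paljutkin Hopf algebra\<close>

definition primitive_root_of_unity :: "nat \<Rightarrow> 'k::field \<Rightarrow> bool" where
  "primitive_root_of_unity n q \<longleftrightarrow> n > 0 \<and> q ^ n = 1 \<and> (\<forall>m. 0 < m \<and> m < n \<longrightarrow> q ^ m \<noteq> 1)"

datatype kp_gen = GX | GY | GZ

abbreviation kp_x :: "(kp_gen, 'k::field) free" where "kp_x \<equiv> gen GX"
abbreviation kp_y :: "(kp_gen, 'k::field) free" where "kp_y \<equiv> gen GY"
abbreviation kp_z :: "(kp_gen, 'k::field) free" where "kp_z \<equiv> gen GZ"

text \<open>A relation \<open>a = b\<close> is encoded as the relator \<open>a - b\<close>.\<close>

definition kp_rels :: "nat \<Rightarrow> 'k::field \<Rightarrow> (kp_gen, 'k) free set" where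
  "kp_rels n q =
     {kp_x ^ n - 1,
      kp_y ^ n - 1,
      kp_x * kp_y - kp_y * kp_x,
      kp_z * kp_x - kp_y * kp_z,
      kp_z * kp_y - kp_x * kp_z,
      kp_z ^ 2 - scalar (1 / of_nat n) *
        (\<Sum>i<n. \<Sum>j<n. scalar (inverse q ^ (i * j)) * kp_x ^ i * kp_y ^ j)}"

fun kp_comul :: "nat \<Rightarrow> 'k::field \<Rightarrow> kp_gen \<Rightarrow> (kp_gen, 'k) free2" where
  "kp_comul n q GX = tens kp_x kp_x"
| "kp_comul n q GY = tens kp_y kp_y"
| "kp_comul n q GZ = scalar (1 / of_nat n) *
     (\<Sum>i<n. \<Sum>j<n. scalar (inverse q ^ (i * j)) * tens (kp_x ^ i) (kp_y ^ j)) * tens kp_z kp_z"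

end

theory Submission
  imports Defs
begin

text \<open>
  Let \<open>\<phi>\<close> be the Haar functional of \<open>H\<close>; it is a trace. Put \<open>c = (\<phi> \<otimes> id) \<chi>\<close>. Applying
  \<open>\<phi> \<otimes> \<phi> \<otimes> id\<close> to \<open>(id \<otimes> \<Delta>) \<chi> = \<chi>\<^sub>1\<^sub>2 + R\<^sub>1\<^sub>2\<^sup>-\<^sup>1 \<chi>\<^sub>1\<^sub>3 R\<^sub>1\<^sub>2\<close> turns the left-hand side
  into \<open>\<phi> c\<close> by invariance, the first summand into \<open>\<phi> c\<close>, and the second one into \<open>c\<close>, because
  \<open>\<phi> \<otimes> \<phi>\<close> is a trace on \<open>H \<otimes> H\<close> and the conjugation by \<open>R\<close> cancels. Hence \<open>c = 0\<close>. Applying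
  \<open>\<phi> \<otimes> id \<otimes> id\<close> to \<open>(\<Delta> \<otimes> id) \<chi> = \<chi>\<^sub>2\<^sub>3 + R\<^sub>2\<^sub>3\<^sup>-\<^sup>1 \<chi>\<^sub>1\<^sub>3 R\<^sub>2\<^sub>3\<close> gives
  \<open>1 \<otimes> c = \<chi> + R\<^sup>-\<^sup>1 (1 \<otimes> c) R\<close>, so \<open>\<chi> = 0\<close>.
\<close>

section \<open>Linear extension\<close>

text \<open>\<open>H\<close> and its tensor powers are quotients of monoid algebras, so \<phi> is
  given by its values on words, and the obstacle is to show that the maps in the argument descend to
  these quotients. For \<phi> \<otimes> id the trace property acts a second time: a relator in the
  first factor may stand between two words, and cyclicity brings it to one end, where \<phi> kills
  it. For invariance, \<Delta> has to respect the relations; the relator that takes work is that of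
  z^2. With p = 1/q, the element J(A,B) = (1/n) \<Sum> p^(ij) A^i B^j is a bicharacter on commuting
  elements whose n-th powers are 1. Since z^2 = J(x,y) and \<Delta>(z) = J(x \<otimes> 1, 1
  \<otimes> y)(z \<otimes> z), the identity \<Delta>(z)^2 = \<Delta>(z^2) is the bilinear expansion
  of J(x \<otimes> x, y \<otimes> y). The functional \<phi> is the coefficient of 1 in the basis x^i
  y^j, x^i y^j z, rewritten as an average over the characters of the group generated by x and y; on
  a character z^2 is a number, so the formula extends to words with any number of letters z.\<close>

lemma scalar_mult_single [simp]: "scalar c * Poly_Mapping.single a d = Poly_Mapping.single a (c * d)"
  by (simp add: mult_single)

lemma single_mult_scalar [simp]: "Poly_Mapping.single a d * scalar c = Poly_Mapping.single a (d * c)"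
  by (simp add: mult_single)

text \<open>\<open>update_induct\<close> inserts a value at a key outside the support, where
  updating is the same as adding a single term. By this rule additive identities are checked on
  basis vectors.\<close>

lemma poly_mapping_single_induct [case_names zero single add]:
  fixes p :: "'a \<Rightarrow>\<^sub>0 'k::comm_monoid_add"
  assumes "P 0" "\<And>a c. P (Poly_Mapping.single a c)" "\<And>p q. P p \<Longrightarrow> P q \<Longrightarrow> P (p + q)"
  shows "P p"
proof (induction p rule: update_induct)
  case const
  show ?case by (rule assms(1))
next
  case (update f a b)
  have "Poly_Mapping.update a b f = f + Poly_Mapping.single a b"
    using update(1) by (intro poly_mapping_eqI)
      (auto simp: lookup_update lookup_add lookup_single when_def in_keys_iff)
  thus ?case using assms(2,3) update by metis
qed

lemma scalar_commute: "scalar c * p = p * scalar c"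
  for p :: "'a::monoid_add \<Rightarrow>\<^sub>0 'k::field"
  by (induction p rule: poly_mapping_single_induct) (simp_all add: algebra_simps)

lemma scalar_mult_left_commute: "p * (scalar c * r) = scalar c * (p * r)"
  for p r :: "'a::monoid_add \<Rightarrow>\<^sub>0 'k::field"
  by (metis mult.assoc scalar_commute)

lemma scalar_mult_mult: "(scalar c * p) * (scalar d * r) = scalar (c * d) * (p * r)"
  for p r :: "'a::monoid_add \<Rightarrow>\<^sub>0 'k::field"
  by (metis add.right_neutral mult.assoc mult_single scalar_commute)

lemma scalar_mult_scalar_mult: "scalar c * (scalar d * p) = scalar (c * d) * p"
  for p :: "'a::monoid_add \<Rightarrow>\<^sub>0 'k::field"
  by (simp flip: mult.assoc)

lemma scalar_sum: "scalar (\<Sum>a\<in>A. f a) = (\<Sum>a\<in>A. scalar (f a) :: 'a::monoid_add \<Rightarrow>\<^sub>0 'k::field)"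
  by (induction A rule: infinite_finite_induct) (simp_all add: single_add)

lemma lin_ext_superset:
  assumes "finite A" "Poly_Mapping.keys p \<subseteq> A"
  shows "lin_ext f p = (\<Sum>a\<in>A. scalar (Poly_Mapping.lookup p a) * f a)"
  unfolding lin_ext_def using assms
  by (intro sum.mono_neutral_left) (auto simp: in_keys_iff)

lemma lin_ext_add [simp]: "lin_ext f (p + q) = lin_ext f p + lin_ext f q"
proof -
  let ?A = "Poly_Mapping.keys p \<union> Poly_Mapping.keys q"
  have "lin_ext f (p + q) = (\<Sum>a\<in>?A. scalar (Poly_Mapping.lookup (p + q) a) * f a)"
    by (intro lin_ext_superset) (use keys_add[of p q] in auto)
  also have "\<dots> = (\<Sum>a\<in>?A. scalar (Poly_Mapping.lookup p a) * f a)
      + (\<Sum>a\<in>?A. scalar (Poly_Mapping.lookup q a) * f a)"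
    by (simp add: lookup_add single_add distrib_right sum.distrib)
  also have "\<dots> = lin_ext f p + lin_ext f q"
    by (simp add: lin_ext_superset[of ?A])
  finally show ?thesis .
qed

lemma lin_ext_single [simp]: "lin_ext f (Poly_Mapping.single a c) = scalar c * f a"
  by (subst lin_ext_superset[of "{a}"]) auto

lemma lin_ext_zero [simp]: "lin_ext f 0 = 0"
  by (simp add: lin_ext_def)

lemma lin_ext_one: "lin_ext f 1 = f 0"
  using lin_ext_single[of f 0 1] by simp

lemma lin_ext_diff [simp]: "lin_ext f (p - q) = lin_ext f p - lin_ext f q"
  by (metis diff_add_cancel eq_diff_eq lin_ext_add)

lemma lin_ext_sum: "lin_ext f (\<Sum>i\<in>A. g i) = (\<Sum>i\<in>A. lin_ext f (g i))"
  by (induction A rule: infinite_finite_induct) simp_all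

lemma lin_ext_scalar: "lin_ext f (scalar c * p) = scalar c * lin_ext f p"
  for p :: "'a::monoid_add \<Rightarrow>\<^sub>0 'k::field"
  by (induction p rule: poly_mapping_single_induct)
     (simp_all add: algebra_simps scalar_mult_scalar_mult)

text \<open>Universal property of the monoid algebra: scalars are central, so a multiplicative map
  on the basis extends to a multiplicative linear map. \<open>push\<close> along monoid
  homomorphisms and \<open>comul_free\<close> are both instances.\<close>

lemma lin_ext_mult:
  assumes "\<And>a b. f (a + b) = f a * f b"
  shows "lin_ext f (p * q) = lin_ext f p * lin_ext f q"
proof (induction p rule: poly_mapping_single_induct)
  case (single a c)
  show ?case
    by (induction q rule: poly_mapping_single_induct)
       (simp_all add: distrib_left distrib_right mult_single assms scalar_mult_mult)
qed (simp_all add: algebra_simps)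

lemma lin_ext_power:
  assumes "\<And>a b. f (a + b) = f a * f b" "f 0 = 1"
  shows "lin_ext f (p ^ m) = lin_ext f p ^ m"
  by (induction m) (simp_all add: lin_ext_mult lin_ext_one assms)

lemma push_single [simp]: "push f (Poly_Mapping.single a c) = Poly_Mapping.single (f a) c"
  by (simp add: push_def)

lemma push_add [simp]: "push f (p + q) = push f p + push f q"
  and push_diff [simp]: "push f (p - q) = push f p - push f q"
  and push_zero [simp]: "push f 0 = 0"
  by (simp_all add: push_def)

definition monoid_add_hom :: "('a::monoid_add \<Rightarrow> 'b::monoid_add) \<Rightarrow> bool" where
  "monoid_add_hom f \<longleftrightarrow> f 0 = 0 \<and> (\<forall>a b. f (a + b) = f a + f b)"

lemma push_mult: "monoid_add_hom f \<Longrightarrow> push f (p * q) = push f p * push f q"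
  unfolding push_def by (intro lin_ext_mult) (simp add: monoid_add_hom_def mult_single)

lemma push_one: "monoid_add_hom f \<Longrightarrow> push f 1 = 1"
  by (simp add: push_def lin_ext_one monoid_add_hom_def)

lemma push_power: "monoid_add_hom f \<Longrightarrow> push f (p ^ m) = push f p ^ m"
  by (induction m) (simp_all add: push_mult push_one)

lemma push_push: "push f (push g p) = push (f \<circ> g) p"
  by (induction p rule: poly_mapping_single_induct) simp_all

lemma monoid_add_hom_embeddings [simp]:
  "monoid_add_hom (\<lambda>a. (a, 0))" "monoid_add_hom (\<lambda>b. (0, b))"
  "monoid_add_hom (\<lambda>b. (0, b, 0))"
  "monoid_add_hom (\<lambda>(u, v). (u, v, 0))" "monoid_add_hom (\<lambda>(u, v). (u, 0, v))"
  by (auto simp: monoid_add_hom_def zero_prod_def)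

lemma tens_single [simp]:
  "tens (Poly_Mapping.single u c) (Poly_Mapping.single v d) = Poly_Mapping.single (u, v) (c * d)"
  by (simp add: tens_def)

text \<open>Turns a tensor into a product of two commuting elements, so that products, powers and
  congruences of tensors reduce to ring arguments about the two embeddings.\<close>

lemma tens_conv_mult: "tens a b = push (\<lambda>u. (u, 0)) a * push (\<lambda>v. (0, v)) b"
proof (induction a rule: poly_mapping_single_induct)
  case (single u c)
  show ?case
    by (induction b rule: poly_mapping_single_induct)
       (simp_all add: tens_def algebra_simps mult_single)
qed (simp_all add: tens_def algebra_simps)

lemma embeddings_commute:
  "push (\<lambda>u. (u, 0)) a * push (\<lambda>v. (0, v)) b = push (\<lambda>v. (0, v)) b * push (\<lambda>u. (u, 0)) a"
proof (induction a rule: poly_mapping_single_induct)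
  case (single u c)
  show ?case
    by (induction b rule: poly_mapping_single_induct)
       (simp_all add: algebra_simps mult_single)
qed (simp_all add: algebra_simps)

lemma tens_mult: "tens a b * tens c d = tens (a * c) (b * d)"
  by (simp add: tens_conv_mult push_mult mult.assoc)
     (metis (no_types) embeddings_commute mult.assoc)

lemma tens_one: "tens 1 1 = 1"
  by (simp add: tens_conv_mult push_one)

lemma tens_power: "tens a b ^ m = tens (a ^ m) (b ^ m)"
  by (induction m) (simp_all add: tens_mult tens_one)


section \<open>Congruence modulo a two-sided ideal\<close>

definition cong_mod :: "'a::ring_1 set \<Rightarrow> 'a \<Rightarrow> 'a \<Rightarrow> bool" where
  "cong_mod I a b \<longleftrightarrow> a - b \<in> I"

text \<open>A counterpart of \<open>ideal\<close> for type class operations, which keeps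
  calculations free of ring records; \<open>ideal_ring_of_type_algebra_iff\<close> identifies the
  two.\<close>

locale two_sided_ideal =
  fixes I :: "'a::ring_1 set"
  assumes zero_mem: "0 \<in> I"
    and add_mem: "\<And>a b. a \<in> I \<Longrightarrow> b \<in> I \<Longrightarrow> a + b \<in> I"
    and left_mem: "\<And>a b. b \<in> I \<Longrightarrow> a * b \<in> I"
    and right_mem: "\<And>a b. a \<in> I \<Longrightarrow> a * b \<in> I"
begin

lemma minus_mem: "a \<in> I \<Longrightarrow> - a \<in> I"
  using left_mem[of a "- 1"] by simp

lemma diff_mem: "a \<in> I \<Longrightarrow> b \<in> I \<Longrightarrow> a - b \<in> I"
  using add_mem[of a "- b"] minus_mem by simp

lemma sum_mem: "(\<And>i. i \<in> A \<Longrightarrow> f i \<in> I) \<Longrightarrow> sum f A \<in> I"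
  by (induction A rule: infinite_finite_induct) (auto simp: zero_mem add_mem)

lemma cong_refl [simp, intro]: "cong_mod I a a"
  by (simp add: cong_mod_def zero_mem)

lemma cong_sym: "cong_mod I a b \<Longrightarrow> cong_mod I b a"
  unfolding cong_mod_def using minus_mem[of "a - b"] by simp

lemma cong_trans [trans]: "cong_mod I a b \<Longrightarrow> cong_mod I b c \<Longrightarrow> cong_mod I a c"
  unfolding cong_mod_def using add_mem[of "a - b" "b - c"] by simp

lemma cong_eq_trans [trans]: "cong_mod I a b \<Longrightarrow> b = c \<Longrightarrow> cong_mod I a c"
  and eq_cong_trans [trans]: "a = b \<Longrightarrow> cong_mod I b c \<Longrightarrow> cong_mod I a c"
  by simp_all

lemma cong_add: "cong_mod I a b \<Longrightarrow> cong_mod I c d \<Longrightarrow> cong_mod I (a + c) (b + d)"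
  unfolding cong_mod_def using add_mem[of "a - b" "c - d"] by (simp add: algebra_simps)

lemma cong_diff: "cong_mod I a b \<Longrightarrow> cong_mod I c d \<Longrightarrow> cong_mod I (a - c) (b - d)"
  unfolding cong_mod_def using diff_mem[of "a - b" "c - d"] by (simp add: algebra_simps)

lemma cong_mult: "cong_mod I a b \<Longrightarrow> cong_mod I c d \<Longrightarrow> cong_mod I (a * c) (b * d)"
proof -
  assume *: "cong_mod I a b" "cong_mod I c d"
  have "a * c - b * d = (a - b) * c + b * (c - d)"
    by (simp add: algebra_simps)
  thus ?thesis using * by (simp add: cong_mod_def add_mem left_mem right_mem)
qed

lemma cong_sum: "(\<And>i. i \<in> A \<Longrightarrow> cong_mod I (f i) (g i)) \<Longrightarrow> cong_mod I (sum f A) (sum g A)"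
  unfolding cong_mod_def by (simp flip: sum_subtractf add: sum_mem)

lemma cong_power: "cong_mod I a b \<Longrightarrow> cong_mod I (a ^ m) (b ^ m)"
  by (induction m) (auto intro: cong_mult)

lemma cong_zero_iff: "cong_mod I a 0 \<longleftrightarrow> a \<in> I"
  by (simp add: cong_mod_def)

text \<open>Serves two purposes: for \<open>a = b\<close> it is commutation with powers, and for
  \<open>c = z\<close> it carries z past powers of x, which become powers of y.\<close>

lemma cong_intertwine_power:
  assumes "cong_mod I (c * a) (b * c)"
  shows "cong_mod I (c * a ^ m) (b ^ m * c)"
proof (induction m)
  case (Suc m)
  have "cong_mod I ((c * a) * a ^ m) ((b * c) * a ^ m)"
    by (rule cong_mult[OF assms cong_refl])
  also have "(b * c) * a ^ m = b * (c * a ^ m)"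
    by (simp add: mult.assoc)
  also have "cong_mod I \<dots> (b * (b ^ m * c))"
    by (rule cong_mult[OF cong_refl Suc])
  finally show ?case by (simp add: mult.assoc)
qed simp

lemma cong_power_mod:
  assumes "cong_mod I (a ^ n) 1"
  shows "cong_mod I (a ^ m) (a ^ (m mod n))"
proof -
  have "a ^ m = (a ^ n) ^ (m div n) * a ^ (m mod n)"
    by (simp flip: power_mult power_add)
  also have "cong_mod I \<dots> (1 ^ (m div n) * a ^ (m mod n))"
    by (intro cong_mult cong_power assms cong_refl)
  finally show ?thesis by simp
qed

definition commutes :: "'a \<Rightarrow> 'a \<Rightarrow> bool" where
  "commutes a b \<longleftrightarrow> cong_mod I (a * b) (b * a)"

lemma commutes_sym: "commutes a b \<Longrightarrow> commutes b a"
  by (simp add: commutes_def cong_sym)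

lemma commutes_refl: "commutes a a"
  by (simp add: commutes_def)

lemma commutes_mult: "commutes a b \<Longrightarrow> commutes a c \<Longrightarrow> commutes a (b * c)"
proof -
  assume *: "commutes a b" "commutes a c"
  have "cong_mod I (a * b * c) (b * a * c)"
    using *(1) by (intro cong_mult[of "a * b"]) (auto simp: commutes_def)
  also have "b * a * c = b * (a * c)"
    by (simp add: mult.assoc)
  also have "cong_mod I \<dots> (b * (c * a))"
    using *(2) by (intro cong_mult[of b b]) (auto simp: commutes_def)
  finally show ?thesis by (simp add: commutes_def mult.assoc)
qed

lemma commutes_power: "commutes a b \<Longrightarrow> commutes a (b ^ m)"
  unfolding commutes_def by (rule cong_intertwine_power)

lemma cong_power_mult_distrib:
  assumes "commutes a b"
  shows "cong_mod I ((a * b) ^ m) (a ^ m * b ^ m)"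
proof (induction m)
  case (Suc m)
  have "cong_mod I ((a * b) ^ Suc m) ((a * b) * (a ^ m * b ^ m))"
    using Suc by (simp add: cong_mult)
  also have "(a * b) * (a ^ m * b ^ m) = a * (b * a ^ m) * b ^ m"
    by (simp add: mult.assoc)
  also have "cong_mod I \<dots> (a * (a ^ m * b) * b ^ m)"
    using commutes_power[OF commutes_sym[OF assms], of m]
    by (intro cong_mult[where a = "a * (b * a ^ m)"] cong_mult[of a a]) (auto simp: commutes_def)
  finally show ?case by (simp add: mult.assoc)
qed simp

end

section \<open>Generated ideals, quotient rings and induced maps\<close>

lemma ideal_ring_of_type_algebra_iff:
  "ideal I (ring_of_type_algebra :: 'a::ring_1 ring) \<longleftrightarrow> two_sided_ideal I"
proof
  assume "ideal I (ring_of_type_algebra :: 'a ring)"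
  then interpret ideal I "ring_of_type_algebra :: 'a ring" .
  show "two_sided_ideal I"
    using additive_subgroup.zero_closed[OF is_additive_subgroup]
      additive_subgroup.a_closed[OF is_additive_subgroup] I_l_closed I_r_closed
    by unfold_locales (simp_all add: ring_of_type_algebra_def)
next
  assume "two_sided_ideal I"
  then interpret two_sided_ideal I .
  interpret R: ring "ring_of_type_algebra :: 'a ring"
    by (rule ring_ring_of_type_algebra)
  have inv: "\<ominus>\<^bsub>ring_of_type_algebra\<^esub> a = - a" for a :: 'a
    unfolding a_inv_def by (rule R.add.inv_char) (auto simp: ring_of_type_algebra_def)
  show "ideal I (ring_of_type_algebra :: 'a ring)"
    by (intro idealI R.ring_axioms R.add.subgroupI)
       (use zero_mem in \<open>auto simp: inv minus_mem add_mem left_mem right_mem\<close>,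
        auto simp: ring_of_type_algebra_def add_mem left_mem right_mem)
qed

lemma two_sided_ideal_Idl:
  "two_sided_ideal (Idl\<^bsub>ring_of_type_algebra\<^esub> (S :: 'a::ring_1 set))"
  unfolding ideal_ring_of_type_algebra_iff[symmetric]
  by (rule ring.genideal_ideal[OF ring_ring_of_type_algebra]) (simp add: ring_of_type_algebra_def)

lemma Idl_mem: "a \<in> S \<Longrightarrow> a \<in> Idl\<^bsub>ring_of_type_algebra\<^esub> (S :: 'a::ring_1 set)"
  by (auto simp: genideal_def)

lemma Idl_subset:
  assumes "two_sided_ideal J" "S \<subseteq> J"
  shows "Idl\<^bsub>ring_of_type_algebra\<^esub> (S :: 'a::ring_1 set) \<subseteq> J"
  using assms by (auto simp: genideal_def ideal_ring_of_type_algebra_iff)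

text \<open>The preimage of \<open>J\<close> under \<open>f\<close> is a two-sided ideal, so with
  \<open>S\<close> it contains everything that \<open>S\<close> generates.\<close>

lemma Idl_image_mem:
  fixes f :: "'a::ring_1 \<Rightarrow> 'b::ring_1"
  assumes "x \<in> Idl\<^bsub>ring_of_type_algebra\<^esub> S" "two_sided_ideal J"
    and add: "\<And>a b. f (a + b) = f a + f b" and mult: "\<And>a b. f (a * b) = f a * f b"
    and S: "\<And>s. s \<in> S \<Longrightarrow> f s \<in> J"
  shows "f x \<in> J"
proof -
  interpret two_sided_ideal J by fact
  have "f 0 = 0" using add[of 0 0] by simp
  hence "two_sided_ideal {x. f x \<in> J}"
    by unfold_locales (auto simp: add mult zero_mem add_mem left_mem right_mem)
  from Idl_subset[OF this, of S] show ?thesis using S assms(1) by auto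
qed

lemma coset_ring_of_type_algebra: "I +>\<^bsub>ring_of_type_algebra\<^esub> a = (\<lambda>i. i + a) ` I"
  by (auto simp: a_r_coset_def' ring_of_type_algebra_def)

context two_sided_ideal
begin

abbreviation coset :: "'a \<Rightarrow> 'a set" where
  "coset a \<equiv> I +>\<^bsub>ring_of_type_algebra\<^esub> a"

abbreviation quot :: "'a set ring" where
  "quot \<equiv> ring_of_type_algebra Quot I"

lemma mem_coset: "x \<in> coset a \<longleftrightarrow> cong_mod I x a"
proof -
  have "x = i + a \<longleftrightarrow> i = x - a" for i
    by auto
  thus ?thesis by (simp add: coset_ring_of_type_algebra cong_mod_def image_iff)
qed

lemma coset_eq_iff: "coset a = coset b \<longleftrightarrow> cong_mod I a b"
  unfolding set_eq_iff mem_coset by (meson cong_refl cong_sym cong_trans)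

lemma carrier_quot: "carrier quot = range coset"
  unfolding FactRing_def A_RCOSETS_def' by (auto simp: ring_of_type_algebra_def)

lemma coset_zero: "coset 0 = I"
  by (simp add: coset_ring_of_type_algebra)

lemma zero_quot: "\<zero>\<^bsub>quot\<^esub> = I"
  by (simp add: FactRing_def)

lemma ideal_I: "ideal I ring_of_type_algebra"
  by (simp add: ideal_ring_of_type_algebra_iff two_sided_ideal_axioms)

lemma coset_hom: "coset \<in> ring_hom ring_of_type_algebra quot"
  by (rule ideal.rcos_ring_hom[OF ideal_I])

lemma ring_quot: "ring quot"
  by (rule ideal.quotient_is_ring[OF ideal_I])

lemma mult_quot: "coset a \<otimes>\<^bsub>quot\<^esub> coset b = coset (a * b)"
  and add_quot: "coset a \<oplus>\<^bsub>quot\<^esub> coset b = coset (a + b)"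
  and one_quot: "\<one>\<^bsub>quot\<^esub> = coset 1"
  using ring_hom_mult[OF coset_hom, of a b] ring_hom_add[OF coset_hom, of a b]
    ring_hom_one[OF coset_hom]
  by (simp_all add: ring_of_type_algebra_def)

lemma Units_quotE:
  assumes "A \<in> Units quot"
  obtains a b where "A = coset a" "cong_mod I (a * b) 1" "cong_mod I (b * a) 1"
proof -
  from assms obtain B where B: "A \<in> carrier quot" "B \<in> carrier quot"
      "B \<otimes>\<^bsub>quot\<^esub> A = \<one>\<^bsub>quot\<^esub>" "A \<otimes>\<^bsub>quot\<^esub> B = \<one>\<^bsub>quot\<^esub>"
    unfolding Units_def by blast
  then obtain a b where "A = coset a" "B = coset b"
    unfolding carrier_quot by blast
  with B show ?thesis by (intro that[of a b]) (simp_all add: mult_quot one_quot coset_eq_iff)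
qed

lemma inv_quot:
  assumes "cong_mod I (a * b) 1" "cong_mod I (b * a) 1"
  shows "inv\<^bsub>quot\<^esub> coset a = coset b"
proof -
  interpret Q: ring quot by (rule ring_quot)
  show ?thesis
    by (rule Q.inv_char) (simp_all add: mult_quot one_quot coset_eq_iff assms carrier_quot rangeI)
qed

end

text \<open>No compatibility of \<open>f\<close> with the ideals is assumed: the union on the left contains \<open>f a\<close>.\<close>

lemma induced_eq_cosetD:
  assumes "two_sided_ideal I" "two_sided_ideal J"
    and "induced J f (I +>\<^bsub>ring_of_type_algebra\<^esub> a) = J +>\<^bsub>ring_of_type_algebra\<^esub> b"
  shows "cong_mod J (f a) b"
proof -
  interpret I: two_sided_ideal I by fact
  interpret J: two_sided_ideal J by fact
  have "a \<in> I.coset a" "f a \<in> J.coset (f a)"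
    by (simp_all add: I.mem_coset J.mem_coset)
  hence "f a \<in> induced J f (I.coset a)"
    unfolding induced_def by blast
  thus ?thesis using assms(3) J.mem_coset by simp
qed

text \<open>A leg of R or \<chi> occurs inside products and sums, so its coset has to be computed,
  which requires that all representatives give the same coset. For the comultiplications of \<chi>,
  which form a whole side of an equation, \<open>induced_eq_cosetD\<close> is enough.\<close>

lemma induced_coset:
  assumes "two_sided_ideal I" "two_sided_ideal J"
    and diff: "\<And>a b. f (a - b) = f a - f b" and mem: "\<And>a. a \<in> I \<Longrightarrow> f a \<in> J"
  shows "induced J f (I +>\<^bsub>ring_of_type_algebra\<^esub> a) = J +>\<^bsub>ring_of_type_algebra\<^esub> f a"
proof -
  interpret I: two_sided_ideal I by fact
  interpret J: two_sided_ideal J by fact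
  have "J.coset (f b) = J.coset (f a)" if "b \<in> I.coset a" for b
    using that by (simp add: I.mem_coset J.coset_eq_iff cong_mod_def mem flip: diff)
  moreover have "a \<in> I.coset a" by (simp add: I.mem_coset)
  ultimately show ?thesis unfolding induced_def by blast
qed


section \<open>Partial evaluation of tensors\<close>

text \<open>The value is returned as a scalar of an arbitrary monoid algebra, so that \<phi>(h) and
  \<phi>(h)1 are the same term and can be compared with \<open>slice\<close>.\<close>

definition evaluate :: "('a \<Rightarrow> 'k) \<Rightarrow> ('a \<Rightarrow>\<^sub>0 'k::field) \<Rightarrow> ('b::monoid_add \<Rightarrow>\<^sub>0 'k)" where
  "evaluate \<phi> = lin_ext (\<lambda>a. scalar (\<phi> a))"

text \<open>This is \<phi> \<otimes> id. As triples are nested pairs, the same constant is \<phi>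
  \<otimes> id \<otimes> id on triples, and two applications give \<phi> \<otimes> \<phi> \<otimes>
  id.\<close>

definition slice :: "('a \<Rightarrow> 'k) \<Rightarrow> ('a \<times> 'b \<Rightarrow>\<^sub>0 'k::field) \<Rightarrow> ('b::monoid_add \<Rightarrow>\<^sub>0 'k)" where
  "slice \<phi> = lin_ext (\<lambda>(a, b). Poly_Mapping.single b (\<phi> a))"

lemma evaluate_single [simp]: "evaluate \<phi> (Poly_Mapping.single a c) = scalar (c * \<phi> a)"
  and evaluate_add [simp]: "evaluate \<phi> (p + r) = evaluate \<phi> p + evaluate \<phi> r"
  and evaluate_diff [simp]: "evaluate \<phi> (p - r) = evaluate \<phi> p - evaluate \<phi> r"
  and evaluate_zero [simp]: "evaluate \<phi> 0 = 0"
  by (simp_all add: evaluate_def)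

lemma evaluate_sum: "evaluate \<phi> (\<Sum>i\<in>A. f i) = (\<Sum>i\<in>A. evaluate \<phi> (f i))"
  by (simp add: evaluate_def lin_ext_sum)

lemma evaluate_scalar: "evaluate \<phi> (scalar c * p) = scalar c * evaluate \<phi> p"
  by (simp add: evaluate_def lin_ext_scalar)

lemma evaluate_mult_commute:
  assumes "\<And>a b. \<phi> (a + b) = \<phi> (b + a)"
  shows "evaluate \<phi> (p * r) = evaluate \<phi> (r * p)"
proof (induction p rule: poly_mapping_single_induct)
  case (single a c)
  show ?case
    by (induction r rule: poly_mapping_single_induct)
       (simp_all add: algebra_simps mult_single assms)
qed (simp_all add: algebra_simps)

lemma slice_single [simp]:
    "slice \<phi> (Poly_Mapping.single (a, b) c) = Poly_Mapping.single b (c * \<phi> a)"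
  and slice_add [simp]: "slice \<phi> (p + r) = slice \<phi> p + slice \<phi> r"
  and slice_diff [simp]: "slice \<phi> (p - r) = slice \<phi> p - slice \<phi> r"
  and slice_zero [simp]: "slice \<phi> 0 = 0"
  by (simp_all add: slice_def)

lemma slice_sum: "slice \<phi> (\<Sum>i\<in>A. f i) = (\<Sum>i\<in>A. slice \<phi> (f i))"
  by (simp add: slice_def lin_ext_sum)

lemma slice_scalar: "slice \<phi> (scalar c * p) = scalar c * slice \<phi> p"
  for p :: "'a::monoid_add \<times> 'b::monoid_add \<Rightarrow>\<^sub>0 'k::field"
  by (simp add: slice_def lin_ext_scalar)

lemma slice_tens: "slice \<phi> (tens a b) = evaluate \<phi> a * b"
proof (induction a rule: poly_mapping_single_induct)
  case (single u c)
  show ?case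
    by (induction b rule: poly_mapping_single_induct)
       (simp_all add: tens_conv_mult algebra_simps mult_single)
qed (simp_all add: tens_conv_mult algebra_simps)

lemma slice_mult_left:
  fixes y :: "'a::monoid_add \<times> 'b::monoid_add \<Rightarrow>\<^sub>0 'k::field"
  shows "slice \<phi> (push (\<lambda>b. (0, b)) c * y) = c * slice \<phi> y"
proof (induction c rule: poly_mapping_single_induct)
  case (single b k)
  show ?case
    by (induction y rule: poly_mapping_single_induct) 
       (auto simp: algebra_simps mult_single split: prod.splits)
qed (simp_all add: algebra_simps)

lemma slice_mult_right:
  fixes y :: "'a::monoid_add \<times> 'b::monoid_add \<Rightarrow>\<^sub>0 'k::field"
  shows "slice \<phi> (y * push (\<lambda>b. (0, b)) c) = slice \<phi> y * c"
proof (induction c rule: poly_mapping_single_induct)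
  case (single b k)
  show ?case
    by (induction y rule: poly_mapping_single_induct) 
       (auto simp: algebra_simps mult_single split: prod.splits)
qed (simp_all add: algebra_simps)

lemma slice_push_zero: "slice \<phi> (push (\<lambda>b. (0, b)) y) = scalar (\<phi> 0) * y"
  by (induction y rule: poly_mapping_single_induct) (simp_all add: algebra_simps)

text \<open>Well-definedness of \<phi> \<otimes> id on a tensor product of quotients: relators in
  the first factor are killed by \<phi>, those in the second factor stay in the ideal.\<close>

lemma slice_mem_Idl:
  fixes x :: "'a::monoid_add \<times> 'b::monoid_add \<Rightarrow>\<^sub>0 'k::field"
  assumes trace: "\<And>a b. \<phi> (a + b) = \<phi> (b + a)"
    and kill: "\<And>a r. r \<in> K \<Longrightarrow> evaluate \<phi> (a * r) = (0 :: 'b \<Rightarrow>\<^sub>0 'k)"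
    and x: "x \<in> Idl\<^bsub>ring_of_type_algebra\<^esub> (push (\<lambda>a. (a, 0)) ` K \<union> push (\<lambda>b. (0, b)) ` B)"
  shows "slice \<phi> x \<in> Idl\<^bsub>ring_of_type_algebra\<^esub> B"
proof -
  define M where "M = Idl\<^bsub>ring_of_type_algebra\<^esub> B"
  interpret M: two_sided_ideal M
    unfolding M_def by (rule two_sided_ideal_Idl)
  \<comment> \<open>\<open>slice\<close> is not multiplicative, so the preimage of \<open>M\<close>
    need not be an ideal. Sandwiching between arbitrary elements builds the closure under
    multiplication into \<open>J\<close>.\<close>
  define J where "J = {x. \<forall>a b. slice \<phi> (a * x * b) \<in> M}"
  have J: "two_sided_ideal J"
  proof
    show "a * b \<in> J" if "b \<in> J" for a b
      using that unfolding J_def mem_Collect_eq by (metis mult.assoc)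
    show "a * b \<in> J" if "a \<in> J" for a b
      using that unfolding J_def mem_Collect_eq by (metis mult.assoc)
  qed (simp_all add: J_def M.zero_mem M.add_mem algebra_simps)
  have left: "push (\<lambda>a. (a, 0)) r \<in> J" if r: "r \<in> K" for r
  proof -
    have "slice \<phi> (a * push (\<lambda>a. (a, 0)) r * b) = (0 :: 'b \<Rightarrow>\<^sub>0 'k)" for a b
    proof (induction a rule: poly_mapping_single_induct)
      case (single w c)
      show ?case
      proof (induction b rule: poly_mapping_single_induct)
        case (single w' d)
        obtain u v u' v' where w: "w = (u, v)" "w' = (u', v')" by fastforce
        have *: "slice \<phi> (Poly_Mapping.single w c * push (\<lambda>a. (a, 0)) s * Poly_Mapping.single w' d)
          = evaluate \<phi> (Poly_Mapping.single u c * s * Poly_Mapping.single u' d)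
            * Poly_Mapping.single (v + v') 1" for s
          unfolding w by (induction s rule: poly_mapping_single_induct)
            (simp_all add: algebra_simps mult_single)
        \<comment> \<open>Cyclicity moves the right factor to the front; what remains is a left
          multiple of \<open>r\<close>, as in \<open>kill\<close>.\<close>
        have **: "evaluate \<phi> (Poly_Mapping.single u c * r * Poly_Mapping.single u' d)
          = (0 :: 'b \<Rightarrow>\<^sub>0 'k)"
          by (subst evaluate_mult_commute, rule trace) (simp add: kill r flip: mult.assoc)
        show ?case by (simp only: * ** mult_zero_left)
      qed (simp_all add: algebra_simps)
    qed (simp_all add: algebra_simps)
    thus ?thesis by (simp add: J_def M.zero_mem)
  qed
  have right: "push (\<lambda>b. (0, b)) r \<in> J" if r: "r \<in> B" for r
  proof -
    have rM: "r \<in> M" unfolding M_def using r by (rule Idl_mem)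
    have "slice \<phi> (a * push (\<lambda>b. (0, b)) r * b) \<in> M" for a b
    proof (induction a rule: poly_mapping_single_induct)
      case (single w c)
      show ?case
      proof (induction b rule: poly_mapping_single_induct)
        case (single w' d)
        obtain u v u' v' where w: "w = (u, v)" "w' = (u', v')" by fastforce
        have "slice \<phi> (Poly_Mapping.single w c * push (\<lambda>b. (0, b)) s * Poly_Mapping.single w' d)
          = Poly_Mapping.single v (c * \<phi> (u + u')) * s * Poly_Mapping.single v' d" for s
          unfolding w by (induction s rule: poly_mapping_single_induct)
            (simp_all add: algebra_simps mult_single)
        thus ?case by (simp add: M.left_mem M.right_mem rM)
      qed (simp_all add: algebra_simps M.zero_mem M.add_mem)
    qed (simp_all add: algebra_simps M.zero_mem M.add_mem)
    thus ?thesis by (simp add: J_def)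
  qed
  have "x \<in> J"
    by (rule subsetD[OF Idl_subset[OF J] x]) (auto intro: left right)
  hence "slice \<phi> (1 * x * 1) \<in> M"
    unfolding J_def by blast
  thus ?thesis by (simp add: M_def)
qed


section \<open>Sums over roots of unity\<close>

lemma primitive_root_inverse:
  "primitive_root_of_unity n q \<Longrightarrow> primitive_root_of_unity n (inverse q)"
  by (auto simp: primitive_root_of_unity_def power_inverse)

lemma primitive_root_nonzero: "primitive_root_of_unity n q \<Longrightarrow> q \<noteq> 0"
  by (auto simp: primitive_root_of_unity_def zero_power)

lemma primitive_root_inj:
  assumes p: "primitive_root_of_unity n p" and less: "j < n" "l < n" and "p ^ j = p ^ l"
  shows "j = l"
proof -
  have "a = b" if "a \<le> b" "b < n" "p ^ a = p ^ b" for a b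
  proof (rule ccontr)
    assume "a \<noteq> b"
    have "p ^ b = p ^ (b - a) * p ^ a" using that(1) by (simp flip: power_add)
    with that(3) have "p ^ (b - a) = 1"
      using primitive_root_nonzero[OF p] by simp
    with p that \<open>a \<noteq> b\<close> show False by (auto simp: primitive_root_of_unity_def)
  qed
  from this[of j l] this[of l j] show ?thesis using assms by (metis nle_le)
qed

text \<open>A geometric sum whose ratio p^(j - l) has n-th power 1 and equals 1 only for j =
  l.\<close>

lemma root_of_unity_orthogonality:
  assumes p: "primitive_root_of_unity n p" and less: "j < n" "l < n"
  shows "(\<Sum>i<n. p ^ (i * j) * inverse p ^ (i * l)) = (if j = l then of_nat n else 0)"
proof -
  have p0: "p \<noteq> 0" and pn: "p ^ n = 1"
    using primitive_root_nonzero[OF p] p by (auto simp: primitive_root_of_unity_def)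
  define r where "r = p ^ j * inverse p ^ l"
  have r: "p ^ (i * j) * inverse p ^ (i * l) = r ^ i" for i
    by (simp add: r_def power_mult_distrib mult.commute flip: power_mult)
  have "r ^ n = (p ^ n) ^ j * inverse ((p ^ n) ^ l)"
    by (simp add: r_def power_mult_distrib power_inverse mult.commute flip: power_mult)
  hence rn: "r ^ n = 1" by (simp add: pn)
  have "r = 1 \<longleftrightarrow> p ^ j = p ^ l"
    using p0 by (simp add: r_def power_inverse field_simps)
  hence "r = 1 \<longleftrightarrow> j = l" using primitive_root_inj[OF p less] by blast
  thus ?thesis by (auto simp: r rn geometric_sum)
qed

text \<open>Shifting by one drops the term k = 0 and adds the term k = n, and these agree modulo
  n.\<close>

lemma sum_shift_mod:
  fixes h :: "nat \<Rightarrow> 'b::ab_group_add"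
  shows "(\<Sum>k<n. h ((i + k) mod n)) = (\<Sum>k<n. h k)"
proof (induction i)
  case (Suc i)
  let ?g = "\<lambda>k. h ((i + k) mod n)"
  have "(\<Sum>k<n. ?g (Suc k)) + ?g 0 = (\<Sum>k<n. ?g k) + ?g n"
    using sum.lessThan_Suc_shift[of ?g n] sum.lessThan_Suc[of ?g n] by (simp add: add.commute)
  thus ?case using Suc by simp
qed simp

lemma sum_rearrange:
  "(\<Sum>i\<in>A. \<Sum>j\<in>B. \<Sum>k\<in>C. \<Sum>l\<in>D. f i j k l) = (\<Sum>j\<in>B. \<Sum>l\<in>D. \<Sum>i\<in>A. \<Sum>k\<in>C. f i j k l)"
proof -
  have "(\<Sum>i\<in>A. \<Sum>j\<in>B. \<Sum>k\<in>C. \<Sum>l\<in>D. f i j k l) = (\<Sum>i\<in>A. \<Sum>j\<in>B. \<Sum>l\<in>D. \<Sum>k\<in>C. f i j k l)"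
    by (subst (3) sum.swap) (rule refl)
  also have "\<dots> = (\<Sum>j\<in>B. \<Sum>i\<in>A. \<Sum>l\<in>D. \<Sum>k\<in>C. f i j k l)"
    by (rule sum.swap)
  also have "\<dots> = (\<Sum>j\<in>B. \<Sum>l\<in>D. \<Sum>i\<in>A. \<Sum>k\<in>C. f i j k l)"
    by (subst (2) sum.swap) (rule refl)
  finally show ?thesis .
qed

text \<open>Polymorphic in the monoid, so that the right-hand side of the relation for z^2 and the
  twist in \<Delta>(z) are instances of one constant.\<close>

definition root_sum :: "nat \<Rightarrow> 'k \<Rightarrow> ('a \<Rightarrow>\<^sub>0 'k) \<Rightarrow> ('a \<Rightarrow>\<^sub>0 'k) \<Rightarrow> ('a::monoid_add \<Rightarrow>\<^sub>0 'k::field)"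
  where "root_sum n p A B = scalar (1 / of_nat n) * (\<Sum>i<n. \<Sum>j<n. scalar (p ^ (i * j)) * A ^ i * B ^ j)"

lemma mult_root_sum_mult:
  "a * root_sum n p A B * b
    = scalar (1 / of_nat n) * (\<Sum>i<n. \<Sum>j<n. scalar (p ^ (i * j)) * (a * (A ^ i * B ^ j) * b))"
proof -
  have pull: "a * (scalar c * A ^ i * B ^ j) * b = scalar c * (a * (A ^ i * B ^ j) * b)" for c i j
    using scalar_mult_left_commute[of a c "A ^ i * B ^ j"] by (simp only: mult.assoc)
  have "a * root_sum n p A B * b = scalar (1 / of_nat n) *
      (a * (\<Sum>i<n. \<Sum>j<n. scalar (p ^ (i * j)) * A ^ i * B ^ j) * b)"
    unfolding root_sum_def by (subst scalar_mult_left_commute) (simp only: mult.assoc)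
  thus ?thesis by (simp only: sum_distrib_left[of a] sum_distrib_right[of _ _ b] pull)
qed

text \<open>Up to the factor n the sums \<Sum> p^(ij) A^i are the eigenprojections of an A with A^n
  = 1, and this is their orthogonality. The condition A^n = 1 is built into the exponents
  \<open>(i + k) mod n\<close>, which makes the statement an equality instead of a
  congruence.\<close>

lemma sum_scalar_power_convolution:
  fixes A :: "'a::monoid_add \<Rightarrow>\<^sub>0 'k::field"
  assumes p: "primitive_root_of_unity n p" and less: "j < n" "l < n"
  shows "(\<Sum>i<n. \<Sum>k<n. scalar (p ^ (i * j) * p ^ (k * l)) * A ^ ((i + k) mod n))
    = (if j = l then scalar (of_nat n) * (\<Sum>m<n. scalar (p ^ (m * j)) * A ^ m) else 0)"
proof -
  have p0: "p \<noteq> 0" and pn: "p ^ n = 1"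
    using primitive_root_nonzero[OF p] p by (auto simp: primitive_root_of_unity_def)
  \<comment> \<open>Here ij + kl = i(j - l) + (i + k)l, and p^n = 1 lets i + k be reduced modulo
    n.\<close>
  have *: "p ^ (i * j) * p ^ (k * l)
      = p ^ (i * j) * inverse p ^ (i * l) * p ^ (((i + k) mod n) * l)" for i k
  proof -
    have "p ^ (i + k) = p ^ (n * ((i + k) div n) + (i + k) mod n)"
      by simp
    also have "\<dots> = p ^ ((i + k) mod n)"
      by (simp only: power_add power_mult pn) simp
    finally have "p ^ (((i + k) mod n) * l) = p ^ (i * l) * p ^ (k * l)"
      by (metis distrib_right power_add power_mult)
    thus ?thesis using p0 by (simp add: power_inverse field_simps)
  qed
  have "(\<Sum>i<n. \<Sum>k<n. scalar (p ^ (i * j) * p ^ (k * l)) * A ^ ((i + k) mod n))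
    = (\<Sum>i<n. \<Sum>k<n. scalar (p ^ (i * j) * inverse p ^ (i * l))
         * (scalar (p ^ (((i + k) mod n) * l)) * A ^ ((i + k) mod n)))"
    by (simp only: * scalar_mult_scalar_mult)
  also have "\<dots> = (\<Sum>i<n. \<Sum>m<n. scalar (p ^ (i * j) * inverse p ^ (i * l))
         * (scalar (p ^ (m * l)) * A ^ m))"
    by (intro sum.cong refl sum_shift_mod)
  also have "\<dots> = scalar (\<Sum>i<n. p ^ (i * j) * inverse p ^ (i * l))
         * (\<Sum>m<n. scalar (p ^ (m * l)) * A ^ m)"
    by (simp only: scalar_sum sum_product)
  finally show ?thesis
    using root_of_unity_orthogonality[OF p less] by simp
qed

text \<open>Modulo \<open>A ^ n = B ^ n = 1\<close>, \<^const>\<open>root_sum\<close> is a bicharacter: it is the element acting on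
  the joint eigenspace with \<open>A = p ^ - a\<close>, \<open>B = p ^ - b\<close> by \<open>p ^ - (a * b)\<close>.\<close>

lemma root_sum_mult_right:
  fixes A B B' :: "'a::monoid_add \<Rightarrow>\<^sub>0 'k::field"
  assumes "two_sided_ideal I" and p: "primitive_root_of_unity n p" and n0: "(of_nat n :: 'k) \<noteq> 0"
    and An: "cong_mod I (A ^ n) 1"
    and comm: "two_sided_ideal.commutes I A B" "two_sided_ideal.commutes I B B'"
  shows "cong_mod I (root_sum n p A B * root_sum n p A B') (root_sum n p A (B * B'))"
proof -
  interpret two_sided_ideal I by fact
  let ?s = "\<lambda>i j k l. scalar (p ^ (i * j) * p ^ (k * l)) :: 'a \<Rightarrow>\<^sub>0 'k"
  let ?c = "scalar (1 / of_nat n * (1 / of_nat n)) :: 'a \<Rightarrow>\<^sub>0 'k"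
  let ?S = "\<Sum>i<n. \<Sum>j<n. \<Sum>k<n. \<Sum>l<n. ?s i j k l * (A ^ ((i + k) mod n) * (B ^ j * B' ^ l))"
  have "root_sum n p A B * root_sum n p A B' =
    ?c * (\<Sum>i<n. \<Sum>j<n. \<Sum>k<n. \<Sum>l<n. (scalar (p ^ (i * j)) * A ^ i * B ^ j)
       * (scalar (p ^ (k * l)) * A ^ k * B' ^ l))"
    unfolding root_sum_def scalar_mult_mult
    by (simp only: sum_distrib_right) (simp only: sum_distrib_left)
  also have "\<dots> = ?c * (\<Sum>i<n. \<Sum>j<n. \<Sum>k<n. \<Sum>l<n. ?s i j k l * (A ^ i * (B ^ j * A ^ k) * B' ^ l))"
  proof -
    have "(scalar (p ^ (i * j)) * A ^ i * B ^ j) * (scalar (p ^ (k * l)) * A ^ k * B' ^ l)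
        = ?s i j k l * (A ^ i * (B ^ j * A ^ k) * B' ^ l)" for i j k l
      using scalar_mult_mult[of "p ^ (i * j)" "A ^ i * B ^ j" "p ^ (k * l)" "A ^ k * B' ^ l"]
      by (simp only: mult.assoc)
    thus ?thesis by (simp only:)
  qed
  finally have expand: "root_sum n p A B * root_sum n p A B' = ?c * (\<Sum>i<n. \<Sum>j<n. \<Sum>k<n. \<Sum>l<n.
    ?s i j k l * (A ^ i * (B ^ j * A ^ k) * B' ^ l))" .
  have cong: "cong_mod I (root_sum n p A B * root_sum n p A B') (?c * ?S)"
    unfolding expand
  proof (rule cong_mult[OF cong_refl], rule cong_sum, rule cong_sum, rule cong_sum, rule cong_sum,
      rule cong_mult[OF cong_refl])
    fix i j k l
    have "cong_mod I (A ^ i * (B ^ j * A ^ k) * B' ^ l) (A ^ i * (A ^ k * B ^ j) * B' ^ l)"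
      using commutes_power[OF commutes_sym[OF commutes_power[OF comm(1)]]] unfolding commutes_def
      by (intro cong_mult[OF cong_mult[OF cong_refl] cong_refl])
    also have "A ^ i * (A ^ k * B ^ j) * B' ^ l = A ^ (i + k) * (B ^ j * B' ^ l)"
      by (simp add: power_add mult.assoc)
    also have "cong_mod I \<dots> (A ^ ((i + k) mod n) * (B ^ j * B' ^ l))"
      by (rule cong_mult[OF cong_power_mod[OF An] cong_refl])
    finally show "cong_mod I (A ^ i * (B ^ j * A ^ k) * B' ^ l)
      (A ^ ((i + k) mod n) * (B ^ j * B' ^ l))" .
  qed
  have "?S = (\<Sum>j<n. \<Sum>l<n. \<Sum>i<n. \<Sum>k<n. ?s i j k l * (A ^ ((i + k) mod n) * (B ^ j * B' ^ l)))"
    by (rule sum_rearrange)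
  also have "\<dots> = (\<Sum>j<n. \<Sum>l<n. (\<Sum>i<n. \<Sum>k<n. ?s i j k l * A ^ ((i + k) mod n)) * (B ^ j * B' ^ l))"
    by (simp only: sum_distrib_right mult.assoc)
  \<comment> \<open>Different eigenprojections annihilate each other, so only j = l survives; the
    factor n cancels one of the two factors 1/n.\<close>
  also have "\<dots> = (\<Sum>j<n. \<Sum>l<n. (if j = l
      then scalar (of_nat n) * (\<Sum>m<n. scalar (p ^ (m * j)) * A ^ m) else 0) * (B ^ j * B' ^ l))"
    by (intro sum.cong refl) (simp add: sum_scalar_power_convolution[OF p])
  also have "\<dots> = (\<Sum>j<n. \<Sum>l<n. if j = l
      then scalar (of_nat n) * (\<Sum>m<n. scalar (p ^ (m * j)) * A ^ m) * (B ^ j * B' ^ l) else 0)"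
    by (intro sum.cong refl) auto
  also have "\<dots> = (\<Sum>j<n. scalar (of_nat n) * (\<Sum>m<n. scalar (p ^ (m * j)) * A ^ m) * (B ^ j * B' ^ j))"
    by (intro sum.cong refl) simp
  also have "\<dots> = scalar (of_nat n) * (\<Sum>m<n. \<Sum>j<n. scalar (p ^ (m * j)) * A ^ m * (B ^ j * B' ^ j))"
  proof -
    have "scalar (of_nat n) * (\<Sum>m<n. scalar (p ^ (m * j)) * A ^ m) * (B ^ j * B' ^ j)
      = (\<Sum>m<n. scalar (of_nat n) * (scalar (p ^ (m * j)) * A ^ m * (B ^ j * B' ^ j)))" for j
      by (simp only: sum_distrib_left sum_distrib_right mult.assoc)
    thus ?thesis
      by (simp only: sum_distrib_left) (rule sum.swap)
  qed
  finally have "?c * ?S = ?c * (scalar (of_nat n) * (\<Sum>m<n. \<Sum>j<n. scalar (p ^ (m * j)) * A ^ m * (B ^ j * B' ^ j)))"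
    by (simp only:)
  also have "\<dots> = scalar (1 / of_nat n) *
      (\<Sum>m<n. \<Sum>j<n. scalar (p ^ (m * j)) * A ^ m * (B ^ j * B' ^ j))"
    using n0 by (simp only: scalar_mult_scalar_mult) simp
  finally have "cong_mod I (root_sum n p A B * root_sum n p A B') (scalar (1 / of_nat n) *
      (\<Sum>m<n. \<Sum>j<n. scalar (p ^ (m * j)) * A ^ m * (B ^ j * B' ^ j)))"
    using cong by (simp only:)
  also have "cong_mod I \<dots> (root_sum n p A (B * B'))"
    unfolding root_sum_def
    by (rule cong_mult[OF cong_refl], rule cong_sum, rule cong_sum, rule cong_mult[OF cong_refl])
       (rule cong_sym[OF cong_power_mult_distrib[OF comm(2)]])
  finally show ?thesis .
qed

text \<open>The exponent ij is symmetric in i and j. This transfers multiplicativity from the second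
  argument to the first.\<close>

lemma root_sum_commute:
  fixes A B :: "'a::monoid_add \<Rightarrow>\<^sub>0 'k::field"
  assumes "two_sided_ideal I" and comm: "two_sided_ideal.commutes I A B"
  shows "cong_mod I (root_sum n p A B) (root_sum n p B A)"
proof -
  interpret two_sided_ideal I by fact
  have "cong_mod I (root_sum n p A B)
    (scalar (1 / of_nat n) * (\<Sum>i<n. \<Sum>j<n. scalar (p ^ (i * j)) * (B ^ j * A ^ i)))"
    unfolding root_sum_def mult.assoc
    by (rule cong_mult[OF cong_refl], rule cong_sum, rule cong_sum, rule cong_mult[OF cong_refl],
        rule commutes_power[OF commutes_sym[OF commutes_power[OF comm]], THEN commutes_sym,
          unfolded commutes_def])
  also have "(\<Sum>i<n. \<Sum>j<n. scalar (p ^ (i * j)) * (B ^ j * A ^ i))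
    = (\<Sum>j<n. \<Sum>i<n. scalar (p ^ (j * i)) * B ^ j * A ^ i)"
    by (subst sum.swap) (simp add: mult.assoc mult.commute[of _ "_ :: nat"])
  finally show ?thesis by (simp add: root_sum_def)
qed

lemma root_sum_mult_left:
  fixes A A' B :: "'a::monoid_add \<Rightarrow>\<^sub>0 'k::field"
  assumes I: "two_sided_ideal I" and "primitive_root_of_unity n p" "(of_nat n :: 'k) \<noteq> 0"
    and "cong_mod I (B ^ n) 1"
    and comm: "two_sided_ideal.commutes I B A" "two_sided_ideal.commutes I B A'"
      "two_sided_ideal.commutes I A A'"
  shows "cong_mod I (root_sum n p A B * root_sum n p A' B) (root_sum n p (A * A') B)"
proof -
  interpret two_sided_ideal I by fact
  note swap = root_sum_commute[OF I]
  have "cong_mod I (root_sum n p A B * root_sum n p A' B) (root_sum n p B A * root_sum n p B A')"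
    by (rule cong_mult[OF swap swap]; rule commutes_sym; rule comm)
  also have "cong_mod I \<dots> (root_sum n p B (A * A'))"
    by (rule root_sum_mult_right[OF assms(1-4) comm(1,3)])
  also have "cong_mod I \<dots> (root_sum n p (A * A') B)"
    by (rule swap[OF commutes_mult[OF comm(1,2)]])
  finally show ?thesis .
qed

text \<open>With \<open>C\<close> equal to z \<otimes> z this carries the twist of \<Delta>(z) past
  z \<otimes> z; with \<open>A' = A\<close> and \<open>B' = B\<close> it is commutation.\<close>

lemma root_sum_intertwine:
  fixes A B C :: "'a::monoid_add \<Rightarrow>\<^sub>0 'k::field"
  assumes "two_sided_ideal I" and A: "cong_mod I (C * A) (A' * C)" and B: "cong_mod I (C * B) (B' * C)"
  shows "cong_mod I (C * root_sum n p A B) (root_sum n p A' B' * C)"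
proof -
  interpret two_sided_ideal I by fact
  have "cong_mod I (C * (A ^ i * B ^ j)) (A' ^ i * B' ^ j * C)" for i j
  proof -
    have "cong_mod I ((C * A ^ i) * B ^ j) ((A' ^ i * C) * B ^ j)"
      by (rule cong_mult[OF cong_intertwine_power[OF A] cong_refl])
    also have "(A' ^ i * C) * B ^ j = A' ^ i * (C * B ^ j)"
      by (simp add: mult.assoc)
    also have "cong_mod I \<dots> (A' ^ i * (B' ^ j * C))"
      by (rule cong_mult[OF cong_refl cong_intertwine_power[OF B]])
    finally show ?thesis by (simp add: mult.assoc)
  qed
  hence "cong_mod I (scalar (1 / of_nat n) * (\<Sum>i<n. \<Sum>j<n. scalar (p ^ (i * j)) * (C * (A ^ i * B ^ j) * 1)))
    (scalar (1 / of_nat n) * (\<Sum>i<n. \<Sum>j<n. scalar (p ^ (i * j)) * (1 * (A' ^ i * B' ^ j) * C)))"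
    by (intro cong_mult[OF cong_refl] cong_sum) simp
  thus ?thesis
    using mult_root_sum_mult[of C n p A B 1] mult_root_sum_mult[of 1 n p A' B' C] by simp
qed

lemma commutes_root_sum:
  fixes A B C :: "'a::monoid_add \<Rightarrow>\<^sub>0 'k::field"
  assumes I: "two_sided_ideal I" and "two_sided_ideal.commutes I C A" "two_sided_ideal.commutes I C B"
  shows "two_sided_ideal.commutes I C (root_sum n p A B)"
  using assms root_sum_intertwine[OF I, of C A A B B]
  by (simp add: two_sided_ideal.commutes_def)

lemma lin_ext_root_sum:
  assumes "\<And>a b. f (a + b) = f a * f b" "f 0 = 1"
  shows "lin_ext f (root_sum n p A B) = root_sum n p (lin_ext f A) (lin_ext f B)"
  by (simp add: root_sum_def lin_ext_scalar lin_ext_sum lin_ext_mult lin_ext_power assms)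

lemma push_root_sum:
  assumes "monoid_add_hom f"
  shows "push f (root_sum n p A B) = root_sum n p (push f A) (push f B)"
  using assms unfolding push_def
  by (intro lin_ext_root_sum) (auto simp: monoid_add_hom_def mult_single)


section \<open>Presented bialgebras\<close>

lemma two_sided_ideal_ideals [simp]:
  "two_sided_ideal (ideal1 rels)" "two_sided_ideal (ideal2 rels)" "two_sided_ideal (ideal3 rels)"
  by (simp_all add: ideal1_def ideal2_def ideal3_def two_sided_ideal_Idl)

lemma rels_mem_ideal1: "r \<in> rels \<Longrightarrow> r \<in> ideal1 rels"
  unfolding ideal1_def by (rule Idl_mem)

lemma push_mem_ideal2:
  assumes "r \<in> ideal1 rels"
  shows "push (\<lambda>u. (u, 0)) r \<in> ideal2 rels" "push (\<lambda>v. (0, v)) r \<in> ideal2 rels"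
  unfolding ideal2_def using assms by (auto intro!: Idl_mem)

lemma push_mem_ideal3:
  assumes "r \<in> ideal1 rels"
  shows "push (\<lambda>u. (u, 0, 0)) r \<in> ideal3 rels" "push (\<lambda>v. (0, v, 0)) r \<in> ideal3 rels"
    "push (\<lambda>w. (0, 0, w)) r \<in> ideal3 rels"
  unfolding ideal3_def using assms by (auto intro!: Idl_mem)

lemma cong_push_ideal2:
  assumes "cong_mod (ideal1 rels) a b"
  shows "cong_mod (ideal2 rels) (push (\<lambda>u. (u, 0)) a) (push (\<lambda>u. (u, 0)) b)"
    "cong_mod (ideal2 rels) (push (\<lambda>v. (0, v)) a) (push (\<lambda>v. (0, v)) b)"
  using assms push_mem_ideal2[of "a - b" rels] by (simp_all add: cong_mod_def)

lemma cong_tens: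
  assumes "cong_mod (ideal1 rels) a a'" "cong_mod (ideal1 rels) b b'"
  shows "cong_mod (ideal2 rels) (tens a b) (tens a' b')"
proof -
  interpret two_sided_ideal "ideal2 rels" by simp
  show ?thesis unfolding tens_conv_mult
    by (rule cong_mult[OF cong_push_ideal2(1)[OF assms(1)] cong_push_ideal2(2)[OF assms(2)]])
qed

lemma leg23_eq: "leg23 = push (\<lambda>v. (0, v))"
  unfolding leg23_def by (rule arg_cong[of _ _ push]) auto

lemma leg_add: "leg12 (a + b) = leg12 a + leg12 b" "leg13 (a + b) = leg13 a + leg13 b"
    "leg23 (a + b) = leg23 a + leg23 b"
  and leg_diff: "leg12 (a - b) = leg12 a - leg12 b" "leg13 (a - b) = leg13 a - leg13 b"
    "leg23 (a - b) = leg23 a - leg23 b"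
  by (simp_all add: leg12_def leg13_def leg23_def)

lemma leg_mult: "leg12 (a * b) = leg12 a * leg12 b" "leg13 (a * b) = leg13 a * leg13 b"
    "leg23 (a * b) = leg23 a * leg23 b"
  and leg_one: "leg12 1 = 1" "leg13 1 = 1" "leg23 1 = 1"
  unfolding leg23_eq by (simp_all add: leg12_def leg13_def push_mult push_one)

lemma leg_mem_ideal3:
  assumes "a \<in> ideal2 rels"
  shows "leg12 a \<in> ideal3 rels" "leg13 a \<in> ideal3 rels" "leg23 a \<in> ideal3 rels"
proof -
  have *: "leg12 s \<in> ideal3 rels \<and> leg13 s \<in> ideal3 rels \<and> leg23 s \<in> ideal3 rels"
    if "s \<in> push (\<lambda>w. (w, 0)) ` ideal1 rels \<union> push (\<lambda>w. (0, w)) ` ideal1 rels" for s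
    using that
    by (auto simp: leg12_def leg13_def leg23_def push_push comp_def push_mem_ideal3)
  note a = assms[unfolded ideal2_def]
  show "leg12 a \<in> ideal3 rels"
    by (rule Idl_image_mem[OF a]) (use * in \<open>auto simp: leg_add leg_mult\<close>)
  show "leg13 a \<in> ideal3 rels"
    by (rule Idl_image_mem[OF a]) (use * in \<open>auto simp: leg_add leg_mult\<close>)
  show "leg23 a \<in> ideal3 rels"
    by (rule Idl_image_mem[OF a]) (use * in \<open>auto simp: leg_add leg_mult\<close>)
qed

lemma prod_list_letters_add:
  "prod_list (map \<delta> (letters (a + b))) = prod_list (map \<delta> (letters a)) * prod_list (map \<delta> (letters b))"
  by (simp add: plus_word_def)

lemma prod_list_letters_zero: "prod_list (map \<delta> (letters 0)) = 1"
  by (simp add: zero_word_def)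

lemmas comul_hom = prod_list_letters_add[of \<delta>] prod_list_letters_zero[of \<delta>] for \<delta>

lemma comul_add [simp]: "comul_free \<delta> (a + b) = comul_free \<delta> a + comul_free \<delta> b"
  and comul_diff [simp]: "comul_free \<delta> (a - b) = comul_free \<delta> a - comul_free \<delta> b"
  and comul_zero [simp]: "comul_free \<delta> 0 = 0"
  and comul_mult [simp]: "comul_free \<delta> (a * b) = comul_free \<delta> a * comul_free \<delta> b"
  and comul_one [simp]: "comul_free \<delta> 1 = 1"
  and comul_power [simp]: "comul_free \<delta> (a ^ m) = comul_free \<delta> a ^ m"
  and comul_root_sum [simp]: "comul_free \<delta> (root_sum n p a b)
    = root_sum n p (comul_free \<delta> a) (comul_free \<delta> b)"
  unfolding comul_free_def
  by (simp_all only: lin_ext_add lin_ext_diff lin_ext_zero lin_ext_mult[OF comul_hom(1)]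
      lin_ext_one comul_hom(2) lin_ext_power[OF comul_hom] lin_ext_root_sum[OF comul_hom])

lemma comul_scalar: "comul_free \<delta> (scalar c * a) = scalar c * comul_free \<delta> a"
  by (simp add: comul_free_def lin_ext_scalar)

lemma comul_gen [simp]: "comul_free \<delta> (gen g) = \<delta> g"
  by (simp add: comul_free_def gen_def)

section \<open>Traces on a presented algebra and their action on tensor powers\<close>

locale trace_functional =
  fixes rels :: "('g, 'k::field) free set" and \<phi> :: "'g word \<Rightarrow> 'k"
  assumes trace: "\<And>u v. \<phi> (u + v) = \<phi> (v + u)"
    and kill: "\<And>a r. r \<in> ideal1 rels \<Longrightarrow> evaluate \<phi> (a * r) = (0 :: ('g, 'k) free)"
begin

sublocale I1: two_sided_ideal "ideal1 rels" by simp
sublocale I2: two_sided_ideal "ideal2 rels" by simp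
sublocale I3: two_sided_ideal "ideal3 rels" by simp

text \<open>The locale assumption fixes the target algebra, while slicing triples needs another one.
  In every target the value is a scalar, determined by one coefficient that does not depend on the
  type.\<close>

lemma kill_poly:
  assumes "r \<in> ideal1 rels"
  shows "evaluate \<phi> (a * r) = (0 :: 'b::monoid_add \<Rightarrow>\<^sub>0 'k)"
proof -
  have "evaluate \<phi> s = scalar (Poly_Mapping.lookup (evaluate \<phi> s :: ('g, 'k) free) 0)" for s :: "('g, 'k) free"
    by (induction s rule: poly_mapping_single_induct) (simp_all add: lookup_add single_add)
  from this[of "a * r"] show ?thesis by (simp add: kill assms)
qed

lemma slice_mem_ideal1:
  assumes "r \<in> ideal2 rels"
  shows "slice \<phi> r \<in> ideal1 rels"
proof -
  have "slice \<phi> r \<in> Idl\<^bsub>ring_of_type_algebra\<^esub> (ideal1 rels)"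
    using assms unfolding ideal2_def by (auto intro: slice_mem_Idl[OF trace kill_poly])
  thus ?thesis using Idl_subset[of "ideal1 rels" "ideal1 rels"] by auto
qed

text \<open>\<open>H \<otimes> H \<otimes> H\<close> is read as
  \<open>H \<otimes> (H \<otimes> H)\<close>: the generators in the last two factors are images of
  the generators of \<open>ideal2\<close>.\<close>

lemma slice_mem_ideal2:
  assumes "r \<in> ideal3 rels"
  shows "slice \<phi> r \<in> ideal2 rels"
proof -
  have "push (\<lambda>w. (w, 0, 0)) ` ideal1 rels \<union> push (\<lambda>w. (0, w, 0)) ` ideal1 rels \<union>
      push (\<lambda>w. (0, 0, w)) ` ideal1 rels
    = push (\<lambda>a. (a, 0)) ` ideal1 rels \<union> push (\<lambda>b. (0, b)) `
      (push (\<lambda>w. (w, 0)) ` ideal1 rels \<union> push (\<lambda>w. (0, w)) ` ideal1 rels)"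
    by (simp add: image_Un image_image push_push comp_def zero_prod_def Un_assoc)
  with assms show ?thesis
    unfolding ideal2_def ideal3_def by (auto intro: slice_mem_Idl[OF trace kill_poly])
qed

lemma cong_slice12: "cong_mod (ideal2 rels) a b \<Longrightarrow> cong_mod (ideal1 rels) (slice \<phi> a) (slice \<phi> b)"
  using slice_mem_ideal1[of "a - b"] by (simp add: cong_mod_def)

lemma cong_slice23: "cong_mod (ideal3 rels) a b \<Longrightarrow> cong_mod (ideal2 rels) (slice \<phi> a) (slice \<phi> b)"
  using slice_mem_ideal2[of "a - b"] by (simp add: cong_mod_def)

lemma slice_leg12: "slice \<phi> (slice \<phi> (leg12 x)) = evaluate \<phi> (slice \<phi> x)"
  by (induction x rule: poly_mapping_single_induct)
     (auto simp: leg12_def algebra_simps)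

lemma slice_leg13: "slice \<phi> (leg13 x) = push (\<lambda>v. (0, v)) (slice \<phi> x)"
  by (induction x rule: poly_mapping_single_induct) (auto simp: leg13_def)

text \<open>\<phi> \<otimes> \<phi> is a trace on the first two legs, and a factor
  \<open>leg12 a\<close> leaves the third leg alone.\<close>

lemma slice_slice_leg12_commute:
  "slice \<phi> (slice \<phi> (leg12 a * y)) = slice \<phi> (slice \<phi> (y * leg12 a))"
proof (induction a rule: poly_mapping_single_induct)
  case (single w c)
  show ?case
    by (induction y rule: poly_mapping_single_induct)
       (auto simp: leg12_def algebra_simps mult_single trace split: prod.splits)
qed (simp_all add: algebra_simps leg_add leg12_def)

end

section \<open>Vanishing in the presence of a normalized invariant trace\<close>

locale haar_trace = trace_functional rels \<phi>
  for rels :: "('g, 'k::field) free set" and \<phi> :: "'g word \<Rightarrow> 'k" +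
  fixes \<delta> :: "'g \<Rightarrow> ('g, 'k) free2"
  assumes normalized: "\<phi> 0 = 1"
    and invariant: "\<And>h. cong_mod (ideal1 rels) (slice \<phi> (comul_free \<delta> h)) (evaluate \<phi> h)"
begin

text \<open>Invariance holds only modulo the relations, hence a congruence. In
  \<open>slice_id_comul\<close> the functional and the comultiplication act on different factors,
  and equality is exact.\<close>

lemma slice_comul_id:
  "cong_mod (ideal2 rels) (slice \<phi> (comul_id_free \<delta> x)) (push (\<lambda>v. (0, v)) (slice \<phi> x))"
proof (induction x rule: poly_mapping_single_induct)
  case (single w c)
  obtain u v where w: "w = (u, v)" by fastforce
  have push: "slice \<phi> (push (\<lambda>(u1, u2). (u1, u2, v)) y) = tens (slice \<phi> y) (Poly_Mapping.single v 1)" for y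
    by (induction y rule: poly_mapping_single_induct)
       (auto simp: tens_conv_mult algebra_simps mult_single)
  have "slice \<phi> (comul_id_free \<delta> (Poly_Mapping.single w c))
    = scalar c * tens (slice \<phi> (comul_free \<delta> (Poly_Mapping.single u 1))) (Poly_Mapping.single v 1)"
    by (simp add: comul_id_free_def w push slice_scalar)
  also have "cong_mod (ideal2 rels) \<dots>
      (scalar c * tens (evaluate \<phi> (Poly_Mapping.single u 1)) (Poly_Mapping.single v 1))"
    by (rule I2.cong_mult[OF I2.cong_refl cong_tens[OF invariant I1.cong_refl]])
  finally show ?case by (simp add: w)
next
  case (add p r)
  thus ?case by (simp add: comul_id_free_def I2.cong_add)
qed (simp_all add: comul_id_free_def)

lemma slice_id_comul: "slice \<phi> (id_comul_free \<delta> x) = comul_free \<delta> (slice \<phi> x)"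
proof (induction x rule: poly_mapping_single_induct)
  case (single w c)
  obtain u v where w: "w = (u, v)" by fastforce
  have push: "slice \<phi> (push (Pair u) y) = scalar (\<phi> u) * y" for y
    by (induction y rule: poly_mapping_single_induct)
       (auto simp: algebra_simps mult_single)
  have "Poly_Mapping.single v (c * \<phi> u) = scalar (c * \<phi> u) * Poly_Mapping.single v 1"
    by simp
  hence "comul_free \<delta> (Poly_Mapping.single v (c * \<phi> u))
    = scalar (c * \<phi> u) * comul_free \<delta> (Poly_Mapping.single v 1)"
    by (simp only: comul_scalar)
  thus ?case by (simp add: id_comul_free_def w push slice_scalar scalar_mult_scalar_mult)
qed (simp_all add: id_comul_free_def)

lemma slice_leg23: "slice \<phi> (leg23 x) = x"
  by (simp add: leg23_eq slice_push_zero normalized)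

lemma infinitesimal_mem_ideal2:
  assumes r: "cong_mod (ideal2 rels) (r * r') 1"
    and id_comul: "cong_mod (ideal3 rels) (id_comul_free \<delta> x)
      (leg12 x + leg12 r' * leg13 x * leg12 r)"
    and comul_id: "cong_mod (ideal3 rels) (comul_id_free \<delta> x)
      (leg23 x + leg23 r' * leg13 x * leg23 r)"
  shows "x \<in> ideal2 rels"
proof -
  define c where "c = slice \<phi> x"
  \<comment> \<open>In the conjugate the order is \<open>r'\<close>, \<open>x\<close>,
    \<open>r\<close>. Cyclicity on the first two legs will bring \<open>leg12 r'\<close> behind
    \<open>leg12 r\<close>, so it is \<open>r * r'\<close> that cancels.\<close>
  have "cong_mod (ideal3 rels) (leg12 r * leg12 r') 1"
    using leg_mem_ideal3(1)[of "r * r' - 1" rels] r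
    by (simp add: cong_mod_def leg_mult leg_diff leg_one)
  hence "cong_mod (ideal3 rels) (leg13 x * (leg12 r * leg12 r')) (leg13 x * 1)"
    by (intro I3.cong_mult I3.cong_refl)
  hence "cong_mod (ideal1 rels) (slice \<phi> (slice \<phi> (leg13 x * leg12 r * leg12 r'))) (slice \<phi> (slice \<phi> (leg13 x)))"
    by (intro cong_slice12 cong_slice23) (simp add: mult.assoc)
  moreover have "slice \<phi> (slice \<phi> (leg13 x)) = c"
    by (simp add: slice_leg13 slice_push_zero normalized c_def)
  ultimately have conj: "cong_mod (ideal1 rels) (slice \<phi> (slice \<phi> (leg12 r' * leg13 x * leg12 r))) c"
    by (simp add: slice_slice_leg12_commute mult.assoc)
  have "cong_mod (ideal1 rels) (slice \<phi> (slice \<phi> (id_comul_free \<delta> x)))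
    (slice \<phi> (slice \<phi> (leg12 x + leg12 r' * leg13 x * leg12 r)))"
    by (intro cong_slice12 cong_slice23 id_comul)
  hence "cong_mod (ideal1 rels) (slice \<phi> (comul_free \<delta> c))
    (evaluate \<phi> c + slice \<phi> (slice \<phi> (leg12 r' * leg13 x * leg12 r)))"
    by (simp add: slice_id_comul slice_leg12 c_def)
  from I1.cong_diff[OF this invariant[of c]]
  have "cong_mod (ideal1 rels) 0 (slice \<phi> (slice \<phi> (leg12 r' * leg13 x * leg12 r)))"
    by simp
  also note conj
  finally have "c \<in> ideal1 rels"
    by (simp add: I1.cong_sym flip: I1.cong_zero_iff)
  hence c: "cong_mod (ideal2 rels) (push (\<lambda>v. (0, v)) c) 0"
    by (simp add: cong_mod_def push_mem_ideal2)

  have "cong_mod (ideal2 rels) (slice \<phi> (comul_id_free \<delta> x))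
    (slice \<phi> (leg23 x + leg23 r' * leg13 x * leg23 r))"
    by (intro cong_slice23 comul_id)
  \<comment> \<open>Factors of the form \<open>leg23\<close> avoid the leg that \<phi> evaluates, so
    \<open>slice\<close> lets \<open>r'\<close> and \<open>r\<close> pass through unchanged.\<close>
  hence "cong_mod (ideal2 rels) (slice \<phi> (comul_id_free \<delta> x)) (x + r' * push (\<lambda>v. (0, v)) c * r)"
    by (simp add: slice_leg23)
       (simp add: leg23_eq slice_mult_left slice_mult_right slice_leg13 c_def)
  also have "cong_mod (ideal2 rels) \<dots> (x + r' * 0 * r)"
    by (intro I2.cong_add I2.cong_mult I2.cong_refl c)
  finally have "cong_mod (ideal2 rels) (slice \<phi> (comul_id_free \<delta> x)) x"
    by simp
  moreover have "cong_mod (ideal2 rels) (slice \<phi> (comul_id_free \<delta> x)) 0"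
    by (rule I2.cong_trans[OF slice_comul_id c[unfolded c_def]])
  ultimately have "cong_mod (ideal2 rels) x 0"
    using I2.cong_sym I2.cong_trans by blast
  thus ?thesis by (simp add: I2.cong_zero_iff)
qed

text \<open>Representatives turn the coset equations into congruences. The leg maps are unital
  homomorphisms, so the legs of \<open>r'\<close> represent the inverses of the legs of R.\<close>

theorem infinitesimal_R_matrix_eq_zero:
  assumes R: "quasitriangular_structure rels \<delta> R" and \<chi>: "infinitesimal_R_matrix rels \<delta> R \<chi>"
  shows "\<chi> = \<zero>\<^bsub>alg2 rels\<^esub>"
proof -
  note alg = alg2_def alg3_def
  have "R \<in> Units I2.quot"
    using R by (simp add: quasitriangular_structure_def Let_def alg)
  then obtain r r' where r: "R = I2.coset r" "cong_mod (ideal2 rels) (r * r') 1"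
      "cong_mod (ideal2 rels) (r' * r) 1"
    by (rule I2.Units_quotE)
  have "\<chi> \<in> carrier I2.quot"
    using \<chi> by (simp add: infinitesimal_R_matrix_def Let_def alg)
  then obtain x where x: "\<chi> = I2.coset x"
    unfolding I2.carrier_quot by blast
  have induced_leg: "induced (ideal3 rels) leg12 (I2.coset a) = I3.coset (leg12 a)"
      "induced (ideal3 rels) leg13 (I2.coset a) = I3.coset (leg13 a)"
      "induced (ideal3 rels) leg23 (I2.coset a) = I3.coset (leg23 a)" for a
    by (rule induced_coset; simp add: leg_diff leg_mem_ideal3)+
  have leg_inv: "cong_mod (ideal3 rels) (leg12 a * leg12 b) 1" "cong_mod (ideal3 rels) (leg23 a * leg23 b) 1"
    if "cong_mod (ideal2 rels) (a * b) 1" for a b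
    using leg_mem_ideal3(1,3)[of "a * b - 1" rels] that
    by (simp_all add: cong_mod_def leg_mult leg_diff leg_one)
  have inv: "inv\<^bsub>I3.quot\<^esub> (I3.coset (leg12 r)) = I3.coset (leg12 r')"
      "inv\<^bsub>I3.quot\<^esub> (I3.coset (leg23 r)) = I3.coset (leg23 r')"
    by (intro I3.inv_quot leg_inv r(2,3))+
  have "induced (ideal3 rels) (id_comul_free \<delta>) (I2.coset x)
      = I3.coset (leg12 x + leg12 r' * leg13 x * leg12 r)"
    "induced (ideal3 rels) (comul_id_free \<delta>) (I2.coset x)
      = I3.coset (leg23 x + leg23 r' * leg13 x * leg23 r)"
    using \<chi> by (simp_all add: infinitesimal_R_matrix_def Let_def alg r(1) x induced_leg inv
        I3.mult_quot I3.add_quot)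
  hence "x \<in> ideal2 rels"
    by (intro infinitesimal_mem_ideal2[OF r(2)] induced_eq_cosetD[where I = "ideal2 rels"]) simp_all
  hence "\<chi> = I2.coset 0"
    unfolding x I2.coset_eq_iff by (simp add: I2.cong_zero_iff)
  thus ?thesis by (simp only: I2.coset_zero alg I2.zero_quot)
qed

end


section \<open>The generalized Kac--Paljutkin Hopf algebra\<close>

text \<open>The exponents \<open>(i, j, t)\<close> of the normal form \<open>x^i y^j z^t\<close> of a word.\<close>

fun kp_exps :: "kp_gen list \<Rightarrow> nat \<times> nat \<times> nat" where
  "kp_exps [] = (0, 0, 0)"
| "kp_exps (GX # w) = (case kp_exps w of (i, j, t) \<Rightarrow> (Suc i, j, t))"
| "kp_exps (GY # w) = (case kp_exps w of (i, j, t) \<Rightarrow> (i, Suc j, t))"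
| "kp_exps (GZ # w) = (case kp_exps w of (i, j, t) \<Rightarrow> (j, i, Suc t))"

text \<open>Moving z^t past the letters of the right-hand word exchanges x and y once for every
  z.\<close>

lemma kp_exps_append:
  "kp_exps (u @ v) = (case kp_exps u of (i, j, t) \<Rightarrow> case kp_exps v of (i', j', t') \<Rightarrow>
     if even t then (i + i', j + j', t + t') else (i + j', j + i', t + t'))"
  by (induction u rule: kp_exps.induct) (auto split: prod.splits)

lemma kp_exps_replicate [simp]:
  "kp_exps (replicate m GX) = (m, 0, 0)" "kp_exps (replicate m GY) = (0, m, 0)"
  "kp_exps (replicate m GZ) = (0, 0, m)"
  by (induction m) simp_all

text \<open>For even \<open>t\<close> this is the normalized trace of \<open>x^i y^j z^t\<close> on the group algebra of
  \<open>\<langle>x, y\<rangle>\<close>: on the eigenvector with eigenvalues \<open>q^a\<close>, \<open>q^b\<close> of \<open>x\<close>, \<open>y\<close>, the element \<open>z^2\<close> acts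
  by \<open>q^(a * b)\<close>.\<close>

definition kp_trace :: "nat \<Rightarrow> 'k::field \<Rightarrow> nat \<times> nat \<times> nat \<Rightarrow> 'k" where
  "kp_trace n q = (\<lambda>(i, j, t). if even t
     then (\<Sum>a<n. \<Sum>b<n. q ^ (i * a + j * b + (t div 2) * (a * b))) / of_nat n ^ 2 else 0)"

definition kp_haar :: "nat \<Rightarrow> 'k::field \<Rightarrow> kp_gen word \<Rightarrow> 'k" where
  "kp_haar n q w = kp_trace n q (kp_exps (letters w))"

lemma kp_trace_swap: "kp_trace n q (i, j, t) = kp_trace n q (j, i, t)"
proof -
  have "(\<Sum>a<n. \<Sum>b<n. q ^ (i * a + j * b + (t div 2) * (a * b)))
    = (\<Sum>b<n. \<Sum>a<n. q ^ (j * b + i * a + (t div 2) * (b * a)))"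
    by (subst sum.swap) (simp add: ac_simps)
  thus ?thesis by (simp add: kp_trace_def)
qed

text \<open>The two orders can differ only when some z-exponent is odd. If exactly one is, both
  sides are 0; if both are, the results differ by exchanging the exponents of x and y, which
  \<open>kp_trace_swap\<close> absorbs.\<close>

lemma kp_haar_commute: "kp_haar n q (u + v) = kp_haar n q (v + u)"
proof -
  obtain i j t where u: "kp_exps (letters u) = (i, j, t)" using prod_cases3 by blast
  obtain i' j' t' where v: "kp_exps (letters v) = (i', j', t')" using prod_cases3 by blast
  show ?thesis
    using kp_trace_swap[of n q "i + j'" "j + i'" "t + t'"]
    by (auto simp: kp_haar_def plus_word_def kp_exps_append u v ac_simps kp_trace_def)
qed

lemma gen_power: "gen g ^ m = Poly_Mapping.single (Word (replicate m g)) (1 :: 'k::field)"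
  by (induction m) (simp_all add: gen_def mult_single plus_word_def flip: single_one zero_word_def)

locale kp =
  fixes n :: nat and q :: "'k::field"
  assumes prim: "primitive_root_of_unity n q" and n0: "(of_nat n :: 'k) \<noteq> 0"
begin

abbreviation p :: 'k where "p \<equiv> inverse q"
abbreviation rels :: "(kp_gen, 'k) free set" where "rels \<equiv> kp_rels n q"
abbreviation \<delta> :: "kp_gen \<Rightarrow> (kp_gen, 'k) free2" where "\<delta> \<equiv> kp_comul n q"
abbreviation haar :: "kp_gen word \<Rightarrow> 'k" where "haar \<equiv> kp_haar n q"
abbreviation x :: "(kp_gen, 'k) free" where "x \<equiv> gen GX"
abbreviation y :: "(kp_gen, 'k) free" where "y \<equiv> gen GY"
abbreviation z :: "(kp_gen, 'k) free" where "z \<equiv> gen GZ"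

sublocale I1: two_sided_ideal "ideal1 rels" by simp
sublocale I2: two_sided_ideal "ideal2 rels" by simp

lemma prim_inverse: "primitive_root_of_unity n p"
  by (rule primitive_root_inverse[OF prim])

lemma qn: "q ^ n = 1" and q0: "q \<noteq> 0" and n_pos: "n > 0"
  using prim primitive_root_nonzero[OF prim] by (auto simp: primitive_root_of_unity_def)

lemma monomial_eq:
  "x ^ i * y ^ j * z ^ t = Poly_Mapping.single (Word (replicate i GX @ replicate j GY @ replicate t GZ)) 1"
  by (simp add: gen_power mult_single plus_word_def)

lemma haar_monomial:
  assumes "kp_exps (letters w) = (i, j, t)"
  shows "evaluate haar (Poly_Mapping.single w c * (x ^ k * y ^ l * z ^ m)) = (scalar (c * kp_trace n q
    (if even t then (i + k, j + l, t + m) else (i + l, j + k, t + m))) :: 'b::monoid_add \<Rightarrow>\<^sub>0 'k)"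
  using assms by (simp add: monomial_eq mult_single kp_haar_def plus_word_def kp_exps_append)

lemma evaluate_monomial:
  "evaluate haar (x ^ k * y ^ l * z ^ m) = (scalar (kp_trace n q (k, l, m)) :: 'b::monoid_add \<Rightarrow>\<^sub>0 'k)"
  by (simp add: monomial_eq kp_haar_def kp_exps_append)

lemma kp_trace_periodic: "kp_trace n q (i + n, j, t) = kp_trace n q (i, j, t)"
proof -
  have "q ^ ((i + n) * a + j * b + (t div 2) * (a * b)) = q ^ (n * a) * q ^ (i * a + j * b + (t div 2) * (a * b))"
    for a b by (simp add: algebra_simps flip: power_add)
  thus ?thesis by (simp add: kp_trace_def power_mult qn)
qed

text \<open>The relation for z^2 tested on eigenvectors: by Fourier inversion (1/n) \<Sum> p^(kl)
  q^(ka + lb) = q^(ab), which is the factor gained when t grows by 2. For odd t both sides are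
  0.\<close>

lemma kp_trace_square:
  "kp_trace n q (i, j, t + 2)
    = 1 / of_nat n * (\<Sum>k<n. \<Sum>l<n. p ^ (k * l) * kp_trace n q (i + k, j + l, t))"
proof (cases "even t")
  case True
  let ?e = "\<lambda>a b. q ^ (i * a + j * b + (t div 2) * (a * b))"
  have orth: "(\<Sum>k<n. \<Sum>l<n. p ^ (k * l) * q ^ (k * a + l * b)) = of_nat n * q ^ (a * b)"
    if "a < n" "b < n" for a b
  proof -
    have "(\<Sum>k<n. \<Sum>l<n. p ^ (k * l) * q ^ (k * a + l * b))
      = (\<Sum>l<n. q ^ (l * b) * (\<Sum>k<n. q ^ (k * a) * p ^ (k * l)))"
      by (subst sum.swap) (simp add: sum_distrib_left power_add mult_ac)
    also have "\<dots> = (\<Sum>l<n. q ^ (l * b) * (if a = l then of_nat n else 0))"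
      using that by (simp add: root_of_unity_orthogonality[OF prim])
    also have "\<dots> = (\<Sum>l<n. if a = l then q ^ (l * b) * of_nat n else 0)"
      by (intro sum.cong) auto
    also have "\<dots> = of_nat n * q ^ (a * b)"
      using that by simp
    finally show ?thesis .
  qed
  have "(\<Sum>k<n. \<Sum>l<n. p ^ (k * l) * (\<Sum>a<n. \<Sum>b<n. q ^ ((i + k) * a + (j + l) * b + (t div 2) * (a * b))))
    = (\<Sum>k<n. \<Sum>l<n. \<Sum>a<n. \<Sum>b<n. ?e a b * (p ^ (k * l) * q ^ (k * a + l * b)))"
    by (simp add: sum_distrib_left power_add algebra_simps)
  also have "\<dots> = (\<Sum>a<n. \<Sum>b<n. \<Sum>k<n. \<Sum>l<n. ?e a b * (p ^ (k * l) * q ^ (k * a + l * b)))"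
    by (subst sum_rearrange, subst sum_rearrange, subst sum.swap)
       (rule sum.cong[OF refl], rule sum.cong[OF refl], rule sum.swap)
  also have "\<dots> = (\<Sum>a<n. \<Sum>b<n. ?e a b * (of_nat n * q ^ (a * b)))"
    by (simp add: orth flip: sum_distrib_left)
  also have "\<dots> = of_nat n * (\<Sum>a<n. \<Sum>b<n. q ^ (i * a + j * b + ((t + 2) div 2) * (a * b)))"
    by (simp add: sum_distrib_left power_add algebra_simps)
  finally show ?thesis
    using True n0 by (simp add: kp_trace_def sum_divide_distrib[symmetric] times_divide_eq_right[symmetric]
        del: times_divide_eq_right) (simp add: sum_divide_distrib[symmetric])
qed (simp add: kp_trace_def)

section \<open>The Haar functional vanishes on the relation ideal\<close>

lemma rels_eq: "rels = {x ^ n - 1, y ^ n - 1, x * y - y * x, z * x - y * z, z * y - x * z,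
    z ^ 2 - root_sum n p x y}"
  by (simp add: kp_rels_def root_sum_def)

lemma evaluate_rels:
  assumes "r \<in> rels"
  shows "evaluate haar (a * r) = (0 :: 'b::monoid_add \<Rightarrow>\<^sub>0 'k)"
proof (induction a rule: poly_mapping_single_induct)
  case (single w c)
  obtain i j t where w: "kp_exps (letters w) = (i, j, t)" using prod_cases3 by blast
  note ev = haar_monomial[OF w, of c, where 'b = 'b]
  let ?w = "Poly_Mapping.single w c"
  have exps: "kp_exps (letters (w + Word [g, h])) = (case kp_exps [g, h] of (i', j', t') \<Rightarrow>
     if even t then (i + i', j + j', t + t') else (i + j', j + i', t + t'))" for g h
    by (simp only: plus_word_def kp_exps_append w word.sel prod.case)
  have two: "evaluate haar (?w * (gen g * gen h))
    = (scalar (c * kp_trace n q (kp_exps (letters (w + Word [g, h])))) :: 'b \<Rightarrow>\<^sub>0 'k)" for g h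
    by (simp add: gen_def mult_single kp_haar_def plus_word_def)
  \<comment> \<open>Behind a word with an odd number of z, the power x^n counts as y^n, so
    periodicity is needed in both exponents.\<close>
  have periodic': "kp_trace n q (i, j + n, t) = kp_trace n q (i, j, t)" for i j t
    by (metis kp_trace_periodic kp_trace_swap)
  consider "r = x ^ n - 1" | "r = y ^ n - 1" | "r = x * y - y * x" | "r = z * x - y * z"
    | "r = z * y - x * z" | "r = z ^ 2 - root_sum n p x y"
    using assms unfolding rels_eq by blast
  thus ?case
  proof cases
    case 1
    thus ?thesis using ev[of n 0 0] ev[of 0 0 0] kp_trace_periodic periodic'
      by (simp add: right_diff_distrib)
  next
    case 2
    thus ?thesis using ev[of 0 n 0] ev[of 0 0 0] kp_trace_periodic periodic'
      by (simp add: right_diff_distrib)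
  next
    case 6
    let ?t = "\<lambda>k l m. if even t then (i + k, j + l, t + m) else (i + l, j + k, t + m)"
    have "evaluate haar (?w * root_sum n p x y) = scalar (1 / of_nat n) * (\<Sum>k<n. \<Sum>l<n.
        scalar (p ^ (k * l)) * (evaluate haar (?w * (x ^ k * y ^ l * z ^ 0)) :: 'b \<Rightarrow>\<^sub>0 'k))"
      using mult_root_sum_mult[of ?w n p x y 1] by (simp add: evaluate_scalar evaluate_sum)
    also have "\<dots> = scalar (c * (1 / of_nat n * (\<Sum>k<n. \<Sum>l<n. p ^ (k * l) * kp_trace n q (?t k l 0))))"
      unfolding ev by (simp add: scalar_sum sum_distrib_left mult_ac)
    \<comment> \<open>The exchange of \<open>k\<close> and \<open>l\<close> in \<open>?t\<close>
      happens only for odd \<open>t\<close>, where every term is 0.\<close>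
    also have "(\<Sum>k<n. \<Sum>l<n. p ^ (k * l) * kp_trace n q (?t k l 0))
      = (\<Sum>k<n. \<Sum>l<n. p ^ (k * l) * kp_trace n q (i + k, j + l, t))"
      by (cases "even t") (simp_all add: kp_trace_def)
    also have "1 / of_nat n * \<dots> = kp_trace n q (?t 0 0 2)"
      using kp_trace_square[of i j t] by simp
    finally show ?thesis using ev[of 0 0 2] 6 by (simp add: right_diff_distrib)
  \<comment> \<open>The remaining relators are differences of two-letter words with equal normal
    form exponents.\<close>
  qed (simp_all add: right_diff_distrib two exps)
qed (simp_all add: algebra_simps)

text \<open>The elements all of whose left multiples are killed form a left ideal; cyclicity turns
  right multiples into left ones, so it is two-sided.\<close>

lemma evaluate_ideal:
  assumes "r \<in> ideal1 rels"
  shows "evaluate haar (a * r) = (0 :: 'b::monoid_add \<Rightarrow>\<^sub>0 'k)"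
proof -
  define J where "J = {r. \<forall>a. evaluate haar (a * r) = (0 :: 'b \<Rightarrow>\<^sub>0 'k)}"
  have "two_sided_ideal J"
  proof
    show "b * r \<in> J" if "r \<in> J" for b r
      using that by (simp add: J_def flip: mult.assoc)
    show "r * b \<in> J" if "r \<in> J" for b r
    proof -
      have "evaluate haar (a * (r * b)) = (evaluate haar (b * a * r) :: 'b \<Rightarrow>\<^sub>0 'k)" for a
        using evaluate_mult_commute[where \<phi> = haar, OF kp_haar_commute, of "a * r" b] by (simp add: mult.assoc)
      thus ?thesis using that by (simp add: J_def)
    qed
  qed (simp_all add: J_def algebra_simps)
  moreover have "rels \<subseteq> J"
    using evaluate_rels by (auto simp: J_def)
  ultimately have "ideal1 rels \<subseteq> J"
    unfolding ideal1_def by (rule Idl_subset)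
  with assms show ?thesis by (auto simp: J_def)
qed

section \<open>The comultiplication respects the relations\<close>

lemma rel_congs:
  "cong_mod (ideal1 rels) (x ^ n) 1" "cong_mod (ideal1 rels) (y ^ n) 1"
  "cong_mod (ideal1 rels) (x * y) (y * x)" "cong_mod (ideal1 rels) (z * x) (y * z)"
  "cong_mod (ideal1 rels) (z * y) (x * z)" "cong_mod (ideal1 rels) (z ^ 2) (root_sum n p x y)"
  unfolding cong_mod_def by (intro rels_mem_ideal1; simp add: rels_eq)+

lemma commutes_xy: "I1.commutes x y"
  using rel_congs(3) by (simp add: I1.commutes_def)

abbreviation x1 :: "(kp_gen, 'k) free2" where "x1 \<equiv> push (\<lambda>u. (u, 0)) x"
abbreviation y1 :: "(kp_gen, 'k) free2" where "y1 \<equiv> push (\<lambda>u. (u, 0)) y"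
abbreviation x2 :: "(kp_gen, 'k) free2" where "x2 \<equiv> push (\<lambda>v. (0, v)) x"
abbreviation y2 :: "(kp_gen, 'k) free2" where "y2 \<equiv> push (\<lambda>v. (0, v)) y"

lemma comul_z: "\<delta> GZ = root_sum n p x1 y2 * tens z z"
  by (simp add: root_sum_def tens_conv_mult push_power mult.assoc)

lemma commutes_push:
  assumes "I1.commutes a b"
  shows "I2.commutes (push (\<lambda>u. (u, 0)) a) (push (\<lambda>u. (u, 0)) b)"
    "I2.commutes (push (\<lambda>v. (0, v)) a) (push (\<lambda>v. (0, v)) b)"
  using cong_push_ideal2[of rels "a * b" "b * a"] assms
  by (simp_all add: I1.commutes_def I2.commutes_def push_mult)

lemma commutes_embeddings: "I2.commutes (push (\<lambda>u. (u, 0)) a) (push (\<lambda>v. (0, v)) b)"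
  by (simp add: I2.commutes_def embeddings_commute)

lemma cong_push_power:
  assumes "cong_mod (ideal1 rels) (a ^ n) 1"
  shows "cong_mod (ideal2 rels) (push (\<lambda>u. (u, 0)) a ^ n) 1" "cong_mod (ideal2 rels) (push (\<lambda>v. (0, v)) a ^ n) 1"
  using cong_push_ideal2[OF assms] by (simp_all add: push_power push_one)

lemmas commutes_pairs = commutes_push[OF commutes_xy] commutes_embeddings
  commutes_push[OF commutes_xy, THEN I2.commutes_sym] commutes_embeddings[THEN I2.commutes_sym]

text \<open>The four factors are what \<Delta>(z)^2 leaves: the twist, the twist after passing z
  \<otimes> z, which exchanges x and y, and the two factors of z^2 \<otimes> z^2. As J is a
  symmetric bicharacter, they are the four terms in the expansion of the right-hand side.\<close>

lemma root_sum_product: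
  "cong_mod (ideal2 rels) (root_sum n p x1 y2 * (root_sum n p y1 x2 * (root_sum n p x1 y1 * root_sum n p x2 y2)))
     (root_sum n p (x1 * x2) (y1 * y2))"
proof -
  let ?J = "root_sum n p"
  note I = two_sided_ideal_ideals(2)[of rels]
  note right = root_sum_mult_right[OF I prim_inverse n0]
  have swap: "cong_mod (ideal2 rels) (?J y1 x2 * ?J x1 y1) (?J x1 y1 * ?J y1 x2)"
  proof -
    have "I2.commutes (?J x1 y1) y1" "I2.commutes (?J x1 y1) x2"
      by (intro I2.commutes_sym[OF commutes_root_sum[OF I]] commutes_pairs I2.commutes_refl)+
    hence "I2.commutes (?J x1 y1) (?J y1 x2)"
      by (rule commutes_root_sum[OF I])
    thus ?thesis by (simp add: I2.commutes_def I2.cong_sym)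
  qed
  have 1: "cong_mod (ideal2 rels) (?J x1 y2 * ?J x1 y1) (?J x1 (y1 * y2))"
    using right[of x1 y2 y1] cong_push_power(1)[OF rel_congs(1)] commutes_pairs
    by (simp add: embeddings_commute)
  have "cong_mod (ideal2 rels) (?J y1 x2 * ?J x2 y2) (?J x2 y1 * ?J x2 y2)"
    by (intro I2.cong_mult I2.cong_refl root_sum_commute[OF I] commutes_pairs)
  also have "cong_mod (ideal2 rels) \<dots> (?J x2 (y1 * y2))"
    by (intro right cong_push_power rel_congs commutes_pairs)
  finally have 2: "cong_mod (ideal2 rels) (?J y1 x2 * ?J x2 y2) (?J x2 (y1 * y2))" .
  \<comment> \<open>Regrouped so that each pair, up to symmetry of J, shares a first argument:
    \<open>x1\<close> on the left, \<open>x2\<close> on the right.\<close>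
  have "?J x1 y2 * (?J y1 x2 * (?J x1 y1 * ?J x2 y2)) = ?J x1 y2 * ((?J y1 x2 * ?J x1 y1) * ?J x2 y2)"
    by (simp add: mult.assoc)
  also have "cong_mod (ideal2 rels) \<dots> (?J x1 y2 * ((?J x1 y1 * ?J y1 x2) * ?J x2 y2))"
    by (rule I2.cong_mult[OF I2.cong_refl I2.cong_mult[OF swap I2.cong_refl]])
  also have "?J x1 y2 * ((?J x1 y1 * ?J y1 x2) * ?J x2 y2) = (?J x1 y2 * ?J x1 y1) * (?J y1 x2 * ?J x2 y2)"
    by (simp add: mult.assoc)
  also have "cong_mod (ideal2 rels) \<dots> (?J x1 (y1 * y2) * ?J x2 (y1 * y2))"
    by (rule I2.cong_mult[OF 1 2])
  also have "cong_mod (ideal2 rels) \<dots> (?J (x1 * x2) (y1 * y2))"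
  proof (rule root_sum_mult_left[OF I prim_inverse n0])
    have "cong_mod (ideal2 rels) ((y1 * y2) ^ n) (y1 ^ n * y2 ^ n)"
      by (intro I2.cong_power_mult_distrib commutes_pairs)
    also have "cong_mod (ideal2 rels) \<dots> (1 * 1)"
      by (intro I2.cong_mult cong_push_power rel_congs)
    finally show "cong_mod (ideal2 rels) ((y1 * y2) ^ n) 1" by simp
    show "I2.commutes (y1 * y2) x1" "I2.commutes (y1 * y2) x2"
      by (rule I2.commutes_sym, intro I2.commutes_mult commutes_pairs)+
  qed (rule commutes_pairs)
  finally show ?thesis .
qed

lemma tens_zz_intertwine:
  "cong_mod (ideal2 rels) (tens z z * x1) (y1 * tens z z)"
  "cong_mod (ideal2 rels) (tens z z * y2) (x2 * tens z z)"
proof -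
  have emb: "push (\<lambda>u. (u, 0)) a = tens a 1" "push (\<lambda>v. (0, v)) a = tens 1 a" for a :: "(kp_gen, 'k) free"
    by (simp_all add: tens_conv_mult push_one)
  show "cong_mod (ideal2 rels) (tens z z * x1) (y1 * tens z z)"
    "cong_mod (ideal2 rels) (tens z z * y2) (x2 * tens z z)"
    unfolding emb tens_mult by (intro cong_tens; simp add: rel_congs)+
qed

lemma comul_rels:
  assumes "r \<in> rels"
  shows "comul_free \<delta> r \<in> ideal2 rels"
proof -
  let ?J = "root_sum n p"
  note I = two_sided_ideal_ideals(2)[of rels]
  have tens_split: "tens a a = push (\<lambda>u. (u, 0)) a * push (\<lambda>v. (0, v)) a" for a :: "(kp_gen, 'k) free"
    by (rule tens_conv_mult)
  \<comment> \<open>The relation z a = b z is applied in both tensor factors; \<open>comm\<close>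
    then moves b \<otimes> b in front of the twist.\<close>
  have zg: "cong_mod (ideal2 rels) (\<delta> GZ * tens a a) (tens b b * \<delta> GZ)"
    if ab: "cong_mod (ideal1 rels) (z * a) (b * z)" and comm: "I2.commutes (tens b b) x1" "I2.commutes (tens b b) y2" for a b
  proof -
    have "\<delta> GZ * tens a a = ?J x1 y2 * tens (z * a) (z * a)"
      by (simp only: comul_z mult.assoc tens_mult)
    also have "cong_mod (ideal2 rels) \<dots> (?J x1 y2 * tens (b * z) (b * z))"
      by (rule I2.cong_mult[OF I2.cong_refl cong_tens[OF ab ab]])
    also have "?J x1 y2 * tens (b * z) (b * z) = ?J x1 y2 * tens b b * tens z z"
      by (simp only: mult.assoc tens_mult)
    also have "cong_mod (ideal2 rels) \<dots> (tens b b * ?J x1 y2 * tens z z)"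
      using commutes_root_sum[OF I comm, of n p]
      by (intro I2.cong_mult[OF _ I2.cong_refl]) (simp add: I2.commutes_def I2.cong_sym)
    finally show ?thesis by (simp only: comul_z mult.assoc)
  qed
  have zz: "cong_mod (ideal2 rels) (\<delta> GZ ^ 2) (?J (tens x x) (tens y y))"
  proof -
    have "\<delta> GZ ^ 2 = ?J x1 y2 * (tens z z * ?J x1 y2) * tens z z"
      by (simp only: comul_z mult.assoc power2_eq_square)
    also have "cong_mod (ideal2 rels) \<dots> (?J x1 y2 * (?J y1 x2 * tens z z) * tens z z)"
      by (intro I2.cong_mult[OF I2.cong_mult[OF I2.cong_refl] I2.cong_refl] root_sum_intertwine[OF I] tens_zz_intertwine)
    also have "?J x1 y2 * (?J y1 x2 * tens z z) * tens z z = ?J x1 y2 * (?J y1 x2 * tens (z ^ 2) (z ^ 2))"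
      by (simp only: mult.assoc tens_mult power2_eq_square)
    also have "cong_mod (ideal2 rels) \<dots> (?J x1 y2 * (?J y1 x2 * tens (?J x y) (?J x y)))"
      by (rule I2.cong_mult[OF I2.cong_refl I2.cong_mult[OF I2.cong_refl cong_tens[OF rel_congs(6) rel_congs(6)]]])
    also have "tens (?J x y) (?J x y) = ?J x1 y1 * ?J x2 y2"
      by (simp add: tens_conv_mult push_root_sum)
    also note root_sum_product
    finally show ?thesis by (simp only: tens_split)
  qed
  have power: "cong_mod (ideal2 rels) (tens a a ^ n) 1" if "cong_mod (ideal1 rels) (a ^ n) 1" for a
    using cong_tens[OF that that] by (simp add: tens_power tens_one)
  have comm_tens: "I2.commutes (tens x x) x1" "I2.commutes (tens x x) y2"
      "I2.commutes (tens y y) x1" "I2.commutes (tens y y) y2"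
    unfolding tens_split
    by (rule I2.commutes_sym, intro I2.commutes_mult commutes_pairs I2.commutes_refl)+
  consider "r = x ^ n - 1" | "r = y ^ n - 1" | "r = x * y - y * x" | "r = z * x - y * z"
    | "r = z * y - x * z" | "r = z ^ 2 - ?J x y"
    using assms unfolding rels_eq by blast
  thus ?thesis
  proof cases
    case 1
    thus ?thesis using power[OF rel_congs(1)] by (simp add: cong_mod_def)
  next
    case 2
    thus ?thesis using power[OF rel_congs(2)] by (simp add: cong_mod_def)
  next
    case 3
    thus ?thesis using cong_tens[OF rel_congs(3) rel_congs(3)] by (simp add: cong_mod_def tens_mult)
  next
    case 4
    thus ?thesis using zg[OF rel_congs(4) comm_tens(3,4)] by (simp add: cong_mod_def del: kp_comul.simps(3))
  next
    case 5
    thus ?thesis using zg[OF rel_congs(5) comm_tens(1,2)] by (simp add: cong_mod_def del: kp_comul.simps(3))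
  next
    case 6
    thus ?thesis using zz by (simp add: cong_mod_def del: kp_comul.simps(3))
  qed
qed

lemma comul_ideal:
  assumes "r \<in> ideal1 rels"
  shows "comul_free \<delta> r \<in> ideal2 rels"
  by (rule Idl_image_mem[OF assms[unfolded ideal1_def]]) (simp_all add: comul_rels)

sublocale trace_functional rels haar
  by unfold_locales (simp_all add: kp_haar_commute evaluate_ideal)

section \<open>Invariance of the Haar functional, by reduction to monomials\<close>

definition haar_invariant :: "(kp_gen, 'k) free \<Rightarrow> bool" where
  "haar_invariant h \<longleftrightarrow> cong_mod (ideal1 rels) (slice haar (comul_free \<delta> h)) (evaluate haar h)"

text \<open>Both sides of the invariance equation descend to \<open>H\<close>: \<phi> kills the
  ideal, and \<Delta> followed by \<phi> \<otimes> id maps it into itself.\<close>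

lemma haar_invariant_cong:
  assumes "cong_mod (ideal1 rels) h h'" "haar_invariant h'"
  shows "haar_invariant h"
proof -
  have "evaluate haar (1 * (h - h')) = (0 :: (kp_gen, 'k) free)"
    by (rule evaluate_ideal) (use assms(1) in \<open>simp add: cong_mod_def\<close>)
  moreover have "slice haar (comul_free \<delta> (h - h')) \<in> ideal1 rels"
    by (intro slice_mem_ideal1 comul_ideal) (use assms(1) in \<open>simp add: cong_mod_def\<close>)
  hence "cong_mod (ideal1 rels) (slice haar (comul_free \<delta> h)) (slice haar (comul_free \<delta> h'))"
    by (simp add: cong_mod_def)
  ultimately show ?thesis
    using assms(2) I1.cong_trans unfolding haar_invariant_def by auto
qed

lemma haar_invariant_add: "haar_invariant a \<Longrightarrow> haar_invariant b \<Longrightarrow> haar_invariant (a + b)"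
  by (simp add: haar_invariant_def I1.cong_add)

lemma haar_invariant_zero: "haar_invariant 0"
  by (simp add: haar_invariant_def)

lemma haar_invariant_scalar: "haar_invariant a \<Longrightarrow> haar_invariant (scalar c * a)"
  by (simp add: haar_invariant_def comul_scalar slice_scalar evaluate_scalar I1.cong_mult
      del: comul_mult)

lemma haar_invariant_sum: "(\<And>i. i \<in> A \<Longrightarrow> haar_invariant (f i)) \<Longrightarrow> haar_invariant (sum f A)"
  by (induction A rule: infinite_finite_induct) (auto intro: haar_invariant_add haar_invariant_zero)

text \<open>Without z the character sum is a product of two geometric sums with ratios q^i and q^j,
  and such a sum vanishes unless its ratio is 1.\<close>

lemma kp_trace_group_like:
  assumes "kp_trace n q (i, j, 0) \<noteq> 0"
  shows "n dvd i" "n dvd j"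
proof -
  have "kp_trace n q (i, j, 0) = (\<Sum>a<n. (q ^ i) ^ a) * (\<Sum>b<n. (q ^ j) ^ b) / of_nat n ^ 2"
    by (simp add: kp_trace_def power_add power_mult sum_product)
  hence "(\<Sum>a<n. (q ^ i) ^ a) \<noteq> 0" "(\<Sum>a<n. (q ^ j) ^ a) \<noteq> 0"
    using assms by auto
  moreover have "n dvd m" if "(\<Sum>a<n. (q ^ m) ^ a) \<noteq> 0" for m
  proof (rule ccontr)
    assume "\<not> n dvd m"
    hence m: "0 < m mod n" "m mod n < n" using n_pos by (auto simp: dvd_eq_mod_eq_0)
    have "q ^ m = q ^ (n * (m div n) + m mod n)" by simp
    also have "\<dots> = q ^ (m mod n)" by (simp only: power_add power_mult qn) simp
    finally have "q ^ m \<noteq> 1" using prim m by (auto simp: primitive_root_of_unity_def)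
    hence "(\<Sum>a<n. (q ^ m) ^ a) = ((q ^ m) ^ n - 1) / (q ^ m - 1)"
      by (rule geometric_sum)
    also have "(q ^ m) ^ n = (q ^ n) ^ m" by (simp add: mult.commute flip: power_mult)
    finally show False using that by (simp add: qn)
  qed
  ultimately show "n dvd i" "n dvd j" by auto
qed

text \<open>For group-like g, (\<phi> \<otimes> id)\<Delta>(g) = \<phi>(g)g. Either \<phi>(g) = 0,
  or n divides both exponents and g is 1 in \<open>H\<close>.\<close>

lemma haar_invariant_group_like: "haar_invariant (x ^ i * y ^ j * z ^ 0)"
proof -
  let ?g = "x ^ i * y ^ j" and ?c = "kp_trace n q (i, j, 0)"
  have "comul_free \<delta> ?g = tens ?g ?g"
    by (simp add: tens_power tens_mult)
  moreover have ev: "evaluate haar ?g = (scalar ?c :: (kp_gen, 'k) free)"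
    using evaluate_monomial[of i j 0, where 'b = "kp_gen word"] by simp
  ultimately have slice: "slice haar (comul_free \<delta> ?g) = scalar ?c * ?g"
    by (simp add: slice_tens del: comul_mult)
  have "cong_mod (ideal1 rels) (scalar ?c * ?g) (scalar ?c * 1)"
  proof (cases "?c = 0")
    case False
    hence ij: "i mod n = 0" "j mod n = 0"
      using kp_trace_group_like by (auto simp: dvd_eq_mod_eq_0)
    have "cong_mod (ideal1 rels) ?g (1 * 1)"
      using I1.cong_power_mod[OF rel_congs(1), of i] I1.cong_power_mod[OF rel_congs(2), of j]
      by (intro I1.cong_mult) (simp_all add: ij)
    thus ?thesis by (intro I1.cong_mult I1.cong_refl) simp
  qed simp
  thus ?thesis
    using slice ev by (simp add: haar_invariant_def del: comul_mult)
qed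

text \<open>Every first tensor factor in the comultiplication contains exactly one z, and \<phi>
  vanishes on words with an odd number of z.\<close>

lemma haar_invariant_z: "haar_invariant (x ^ i * y ^ j * z ^ 1)"
proof -
  let ?g = "x ^ i * y ^ j"
  have vanish: "evaluate haar (?g * x ^ k * z) = (0 :: (kp_gen, 'k) free)" for k
  proof -
    have "?g * x ^ k * z = Poly_Mapping.single (Word (replicate i GX @ replicate j GY @ replicate k GX @ [GZ])) 1"
      by (simp add: gen_power gen_def[of GZ] mult_single plus_word_def)
    thus ?thesis by (simp add: kp_haar_def kp_exps_append kp_trace_def)
  qed
  have "comul_free \<delta> (?g * z) = tens ?g ?g * root_sum n p x1 y2 * tens z z"
  proof -
    have "comul_free \<delta> ?g = tens ?g ?g"
      by (simp add: tens_power tens_mult)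
    thus ?thesis
      by (simp only: comul_mult[of _ ?g z] comul_gen comul_z) (simp only: mult.assoc)
  qed
  also have "\<dots> = scalar (1 / of_nat n) *
     (\<Sum>k<n. \<Sum>l<n. scalar (p ^ (k * l)) * tens (?g * x ^ k * z) (?g * y ^ l * z))"
    unfolding mult_root_sum_mult by (simp add: tens_mult mult.assoc flip: push_power tens_conv_mult)
  finally have "slice haar (comul_free \<delta> (?g * z)) = 0"
    by (simp add: slice_scalar slice_sum slice_tens vanish)
  moreover have "evaluate haar (?g * z) = (0 :: (kp_gen, 'k) free)"
    using vanish[of 0] by simp
  ultimately show ?thesis by (simp add: haar_invariant_def)
qed

text \<open>The relation for z^2 lowers t by 2 and spreads the monomial over other exponents of x
  and y, so \<open>i\<close> and \<open>j\<close> stay arbitrary in the induction.\<close>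

lemma haar_invariant_monomial: "haar_invariant (x ^ i * y ^ j * z ^ t)"
proof (induction t arbitrary: i j rule: less_induct)
  case (less t)
  consider "t = 0" | "t = 1" | s where "t = s + 2"
    by (metis One_nat_def add_2_eq_Suc' not0_implies_Suc)
  thus ?case
  proof cases
    case 1
    thus ?thesis using haar_invariant_group_like by simp
  next
    case 2
    thus ?thesis using haar_invariant_z by simp
  next
    case 3
    have "x ^ i * y ^ j * z ^ t = x ^ i * y ^ j * (z ^ 2 * z ^ s)"
      by (simp only: 3 flip: power_add) (simp add: add.commute)
    also have "cong_mod (ideal1 rels) \<dots> (x ^ i * y ^ j * (root_sum n p x y * z ^ s))"
      by (intro I1.cong_mult I1.cong_refl rel_congs)
    also have "x ^ i * y ^ j * (root_sum n p x y * z ^ s) = scalar (1 / of_nat n) *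
      (\<Sum>k<n. \<Sum>l<n. scalar (p ^ (k * l)) * (x ^ i * (y ^ j * x ^ k) * y ^ l * z ^ s))"
      using mult_root_sum_mult[of "x ^ i * y ^ j" n p x y "z ^ s"] by (simp only: mult.assoc)
    finally have cong: "cong_mod (ideal1 rels) (x ^ i * y ^ j * z ^ t) \<dots>" .
    have "haar_invariant (x ^ i * (y ^ j * x ^ k) * y ^ l * z ^ s)" for k l
    proof (rule haar_invariant_cong)
      have yx: "cong_mod (ideal1 rels) (y ^ j * x ^ k) (x ^ k * y ^ j)"
        using I1.commutes_power[OF I1.commutes_sym[OF I1.commutes_power[OF commutes_xy]]]
        unfolding I1.commutes_def .
      have "cong_mod (ideal1 rels) (x ^ i * (y ^ j * x ^ k) * y ^ l * z ^ s)
        (x ^ i * (x ^ k * y ^ j) * y ^ l * z ^ s)"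
        by (rule I1.cong_mult[OF I1.cong_mult[OF I1.cong_mult[OF I1.cong_refl yx] I1.cong_refl] I1.cong_refl])
      thus "cong_mod (ideal1 rels) (x ^ i * (y ^ j * x ^ k) * y ^ l * z ^ s)
        (x ^ (i + k) * y ^ (j + l) * z ^ s)"
        by (simp add: power_add mult.assoc)
      show "haar_invariant (x ^ (i + k) * y ^ (j + l) * z ^ s)"
        using 3 by (intro less.IH) simp
    qed
    thus ?thesis
      by (intro haar_invariant_cong[OF cong] haar_invariant_scalar haar_invariant_sum)
  qed
qed

lemma word_cong_monomial:
  "cong_mod (ideal1 rels) (Poly_Mapping.single (Word w) 1)
     (case kp_exps w of (i, j, t) \<Rightarrow> x ^ i * y ^ j * z ^ t)"
proof (induction w)
  case Nil
  show ?case by (simp flip: zero_word_def)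
next
  case (Cons g w)
  obtain i j t where w: "kp_exps w = (i, j, t)" using prod_cases3 by blast
  have "Poly_Mapping.single (Word (g # w)) 1 = gen g * Poly_Mapping.single (Word w) (1 :: 'k)"
    by (simp add: gen_def mult_single plus_word_def)
  also have "cong_mod (ideal1 rels) \<dots> (gen g * (x ^ i * y ^ j * z ^ t))"
    using Cons w by (intro I1.cong_mult I1.cong_refl) simp
  finally have step: "cong_mod (ideal1 rels) (Poly_Mapping.single (Word (g # w)) 1)
    (gen g * (x ^ i * y ^ j * z ^ t))" .
  show ?case
  proof (cases g)
    case GX
    thus ?thesis using step by (simp add: w mult.assoc)
  next
    case GY
    have "cong_mod (ideal1 rels) (y * x ^ i * (y ^ j * z ^ t)) (x ^ i * y * (y ^ j * z ^ t))"
      using I1.commutes_power[OF I1.commutes_sym[OF commutes_xy]]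
      by (intro I1.cong_mult[OF _ I1.cong_refl]) (simp add: I1.commutes_def)
    thus ?thesis using step GY by (auto simp: w mult.assoc intro: I1.cong_trans)
  next
    \<comment> \<open>z x^i y^j = y^i z y^j = y^i x^j z, the exchange of exponents in the last
      equation of \<open>kp_exps\<close>.\<close>
    case GZ
    have "cong_mod (ideal1 rels) ((z * x ^ i) * (y ^ j * z ^ t)) ((y ^ i * z) * (y ^ j * z ^ t))"
      by (rule I1.cong_mult[OF I1.cong_intertwine_power[OF rel_congs(4)] I1.cong_refl])
    also have "(y ^ i * z) * (y ^ j * z ^ t) = y ^ i * (z * y ^ j) * z ^ t"
      by (simp add: mult.assoc)
    also have "cong_mod (ideal1 rels) \<dots> (y ^ i * (x ^ j * z) * z ^ t)"
      by (rule I1.cong_mult[OF I1.cong_mult[OF I1.cong_refl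
            I1.cong_intertwine_power[OF rel_congs(5)]] I1.cong_refl])
    also have "y ^ i * (x ^ j * z) * z ^ t = (y ^ i * x ^ j) * z ^ Suc t"
      by (simp add: mult.assoc)
    also have "cong_mod (ideal1 rels) \<dots> ((x ^ j * y ^ i) * z ^ Suc t)"
      using I1.commutes_power[OF I1.commutes_sym[OF I1.commutes_power[OF commutes_xy]]]
      unfolding I1.commutes_def by (rule I1.cong_mult[OF _ I1.cong_refl])
    finally show ?thesis using step GZ by (auto simp: w mult.assoc intro: I1.cong_trans)
  qed
qed

lemma haar_invariant_all: "haar_invariant h"
proof (induction h rule: poly_mapping_single_induct)
  case (single w c)
  have "haar_invariant (Poly_Mapping.single w 1)"
    using haar_invariant_cong[OF word_cong_monomial[of "letters w"]] haar_invariant_monomial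
    by (simp split: prod.splits)
  from haar_invariant_scalar[OF this, of c] show ?case by simp
qed (auto intro: haar_invariant_zero haar_invariant_add)

lemma haar_one: "haar 0 = 1"
  using n0 by (simp add: kp_haar_def zero_word_def kp_trace_def power2_eq_square)

sublocale haar_trace rels haar \<delta>
  using haar_one haar_invariant_all by unfold_locales (simp_all add: haar_invariant_def)

end

theorem theorem4p8:
  fixes n :: nat and q :: "'k::field"
    and R \<chi> :: "(kp_gen, 'k) free2 set"
  assumes "n \<ge> 3"
    and "\<not> CHAR('k) dvd 2 * n ^ 2"
    and "primitive_root_of_unity n q"
    and "quasitriangular_structure (kp_rels n q) (kp_comul n q) R"
    and "infinitesimal_R_matrix (kp_rels n q) (kp_comul n q) R \<chi>"
  shows "\<chi> = \<zero>\<^bsub>alg2 (kp_rels n q)\<^esub>"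
proof -
  \<comment> \<open>A characteristic dividing n would divide 2 n^2. Invertibility of n is what the
    averages over roots of unity rest on.\<close>
  have "(of_nat n :: 'k) \<noteq> 0"
    using assms(2) by (auto simp: of_nat_eq_0_iff_char_dvd power2_eq_square)
  then interpret kp n q
    using assms(3) by unfold_locales
  show ?thesis
    by (rule infinitesimal_R_matrix_eq_zero[OF assms(4,5)])
qed

end
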